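(* Let $d\ge2$ and let $\nu$ be the product of the uniform probabilities on the space of sequences $U=(u_k)_{k\in\mathfrak S_d}$ with $u_k\in\mathbb S_k$ for all $k\in\mathfrak S_d$. Then $$\nu\big(\{U:\ \exists C>0,\ \forall k\in\mathfrak S_d,\ \|u_k\|_{L^\infty(\mathbb T^d)}\le C\}\big)=0.$$
   Context: $\mathbb T^d=(\mathbb R/2\pi\mathbb Z)^d$ is the flat torus. For $k\in\mathbb N$, $E_k$ is the eigenspace of $-\mathbf\Delta$ on $\mathbb T^d$ for the eigenvalue $k$, i.e. the complex span of $e^{in\cdot x}$, $n\in J_k=\{n\in\mathbb Z^d:\ |n|^2=k\}$, with the $L^2(\mathbb T^d)$ norm; $N_k=\#J_k$ is its dimension, $\mathfrak S_d=\{k\in\mathbb N:\ N_k\ge1\}$. For $k\in\mathfrak S_d$, $\mathbb S_k$ is the unit sphere of $E_k$ with its uniform probability, and $\prod_{k\in\mathfrak S_d}\mathbb S_k$ carries the product probability $\nu$. *)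

theory Defs
  imports "HOL-Probability.Probability"
begin

text \<open>Functions on the torus are $2\pi$-periodic functions on \<open>real ^ 'd\<close>; the half-open cube is
  a fundamental domain, and the flat torus as a measure space is this cube with Lebesgue measure
  (total mass $(2\pi)^d$).\<close>

definition torus :: "(real ^ 'd) measure" where
  "torus = restrict_space lborel {x. \<forall>i. 0 \<le> x $ i \<and> x $ i < 2 * pi}"

definition L2_norm :: "(real ^ 'd \<Rightarrow> complex) \<Rightarrow> real" where
  "L2_norm u = sqrt (\<integral>x. (cmod (u x))\<^sup>2 \<partial>torus)"

definition Linf_norm :: "(real ^ 'd \<Rightarrow> complex) \<Rightarrow> ereal" where
  "Linf_norm u = esssup torus (\<lambda>x. ereal (cmod (u x)))"

definition freqs :: "nat \<Rightarrow> (int ^ 'd) set" where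
  "freqs k = {n. (\<Sum>i\<in>UNIV. (n $ i)\<^sup>2) = int k}"

definition eig_mult :: "'d::finite itself \<Rightarrow> nat \<Rightarrow> nat" where
  "eig_mult _ k = card (freqs k :: (int ^ 'd) set)"

definition eigenvalues :: "'d::finite itself \<Rightarrow> nat set" where
  "eigenvalues d = {k. eig_mult d k \<ge> 1}"

definition fourier_char :: "int ^ 'd \<Rightarrow> real ^ 'd \<Rightarrow> complex" where
  "fourier_char n x = exp (\<i> * of_real (\<Sum>i\<in>UNIV. of_int (n $ i) * x $ i))"

definition trig_poly :: "nat \<Rightarrow> (int ^ 'd \<Rightarrow> complex) \<Rightarrow> real ^ 'd \<Rightarrow> complex" where
  "trig_poly k c = (\<lambda>x. \<Sum>n\<in>freqs k. c n * fourier_char n x)"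

definition eigenspace :: "nat \<Rightarrow> (real ^ 'd \<Rightarrow> complex) set" where
  "eigenspace k = range (trig_poly k)"

definition unit_sphere :: "nat \<Rightarrow> (real ^ 'd \<Rightarrow> complex) set" where
  "unit_sphere k = {u \<in> eigenspace k. L2_norm u = 1}"

definition sphere_borel :: "nat \<Rightarrow> (real ^ 'd \<Rightarrow> complex) measure" where
  "sphere_borel k = sigma (unit_sphere k)
     {V. openin (Metric_space.mtopology (unit_sphere k) (\<lambda>u v. L2_norm (\<lambda>x. u x - v x))) V}"

text \<open>The uniform probability on the unit sphere is the image of normalised Lebesgue measure on the
  punctured unit ball of the eigenspace under the radial projection.  Lebesgue measure on the
  eigenspace is taken in the coordinates given by the exponentials \<open>fourier_char n\<close>, which are pairwise orthogonal of
  the same norm $(2\pi)^{d/2}$, so it is a constant multiple of the one induced by the $L^2$ inner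
  product; the constant disappears in the normalisation.\<close>

definition ball_coeffs :: "nat \<Rightarrow> (int ^ 'd \<Rightarrow> complex) set" where
  "ball_coeffs k = {c \<in> freqs k \<rightarrow>\<^sub>E UNIV. 0 < L2_norm (trig_poly k c) \<and> L2_norm (trig_poly k c) \<le> 1}"

definition ball_uniform :: "nat \<Rightarrow> (int ^ 'd \<Rightarrow> complex) measure" where
  "ball_uniform k =
     uniform_measure (restrict_space (\<Pi>\<^sub>M n\<in>freqs k. lborel) (ball_coeffs k)) (ball_coeffs k)"

definition sphere_uniform :: "nat \<Rightarrow> (real ^ 'd \<Rightarrow> complex) measure" where
  "sphere_uniform k = distr (ball_uniform k) (sphere_borel k)
     (\<lambda>c x. trig_poly k c x / of_real (L2_norm (trig_poly k c)))"

definition nu :: "(nat \<Rightarrow> real ^ 'd \<Rightarrow> complex) measure" where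
  "nu = (\<Pi>\<^sub>M k\<in>eigenvalues TYPE('d). sphere_uniform k)"

end

theory Submission imports Defs begin

text \<open>For $u = \sum_n c_n e^{in\cdot x}$ uniform on the unit sphere, $u(0) = \sum_n c_n$ is approximately a complex
  Gaussian whose variance does not depend on $k$ when $N_k$ is large, so $P(|u_k(0)| > C)$ is bounded below as
  $N_k \to \infty$.  Since $N_k$ is unbounded for $d \ge 2$, independence gives probability $0$.

  The lower bound avoids rotating coordinates. With $S = \sum_n \mathrm{Re}\, c_n$ and $B_R = \{\sum_n |c_n|^2 \le R\}$, sign flips
  show that the average of $S^2$ over $B_R$ is at most $R$, so by Chebyshev and the symmetry $c \mapsto -c$ a quarter of $B_R$
  satisfies $0 \le S$, $S^2 < 2R$.  Translating all coordinates by $a/N$ adds $a$ to $S$ and only $O(1/N)$ to $\sum_n |c_n|^2$,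
  and shrinking $R$ by $O(1/N)$ changes the volume of $B_R$ by a bounded factor.\<close>

subsection \<open>Balls in coefficient space\<close>

text \<open>The law on each sphere is a radial image of Lebesgue measure on a punctured ball, so
  every probability is a ratio of volumes in coefficient space and the estimate is made there. Two
  facts carry it to the sphere. Projecting a point of the unit ball outwards divides by a norm at
  most 1, which can only enlarge the value at 0. By Parseval the unit ball is \<open>sq_ball\<close>
  with parameter (2 pi)^(-d), the same for every k, so the volume fraction obtained depends on d and
  C but not on k. A drift of order 1/N in the squared norm is what a volume of real dimension 2N can
  absorb: a fixed relative shrinkage would cost an exponentially small factor, while (1 - x/N)^N
  stays bounded below. The rest is measure theory: a bounded sup norm must be an event for the
  sigma-algebra generated by the L2-open sets of functions, the radial map must be measurable into
  it, and the essential supremum must control the value at 0, which is a corner of the fundamental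
  cell.\<close>

abbreviation cspace :: "'i set \<Rightarrow> ('i \<Rightarrow> complex) measure" where
  "cspace I \<equiv> \<Pi>\<^sub>M i\<in>I. lborel"

interpretation lborel_complex: product_sigma_finite "\<lambda>_. lborel :: complex measure" ..

section \<open>Affine changes of variable\<close>

lemma emeasure_lborel_affine_complex:
  fixes t :: complex and s :: real
  assumes "s \<noteq> 0" "A \<in> sets borel"
  shows "emeasure lborel A = ennreal (s\<^sup>2) * emeasure lborel ((\<lambda>x. t + s *\<^sub>R x) -` A)"
proof -
  have "emeasure lborel A = emeasure (density (distr lborel borel (\<lambda>x. t + s *\<^sub>R x)) (\<lambda>_. \<bar>s\<bar>^DIM(complex))) A"
    using lborel_affine[OF assms(1), of t] by simp
  also have "\<dots> = ennreal (s\<^sup>2) * emeasure (distr lborel borel (\<lambda>x. t + s *\<^sub>R x)) A"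
    using assms(2) by (subst emeasure_density_const) auto
  also have "emeasure (distr lborel borel (\<lambda>x. t + s *\<^sub>R x)) A = emeasure lborel ((\<lambda>x. t + s *\<^sub>R x) -` A)"
    using assms(2) by (subst emeasure_distr) auto
  finally show ?thesis .
qed

lemma emeasure_lborel_open_pos:
  fixes S :: "'a::euclidean_space set"
  assumes "open S" "S \<noteq> {}" shows "emeasure lborel S > 0"
proof -
  obtain x r where r: "r > 0" "ball x r \<subseteq> S"
    using assms by (meson ex_in_conv openE)
  have "emeasure lborel (ball x r) > 0"
    using content_ball_pos[OF r(1), of x] by (metis enn2real_0 less_irrefl measure_def not_gr_zero)
  also have "\<dots> \<le> emeasure lborel S" using r assms by (intro emeasure_mono) auto
  finally show ?thesis .
qed

text \<open>The scale may vary with the coordinate so that a single sign can be flipped; restricting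
  to \<open>I\<close> keeps the image extensional, hence in \<open>space (cspace I)\<close>.\<close>

definition affine_map :: "'i set \<Rightarrow> ('i \<Rightarrow> complex) \<Rightarrow> ('i \<Rightarrow> real) \<Rightarrow> ('i \<Rightarrow> complex) \<Rightarrow> 'i \<Rightarrow> complex" where
  "affine_map I t s c = (\<lambda>i\<in>I. t i + s i *\<^sub>R c i)"

lemma measurable_affine_map [measurable]: "affine_map I t s \<in> measurable (cspace I) (cspace I)"
  unfolding affine_map_def by measurable

text \<open>A product measure is determined by its values on boxes, and on a box the map acts one
  coordinate at a time, each contributing the factor \<open>r\<^sup>2\<close> of a plane dilation.
  Only the squares of the scales have to agree, so the same lemma serves dilations, translations and
  sign flips.\<close>

lemma emeasure_cspace_affine:
  fixes s :: "'i \<Rightarrow> real"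
  assumes "finite I" "r \<noteq> 0" and s: "\<And>i. i \<in> I \<Longrightarrow> (s i)\<^sup>2 = r\<^sup>2" and A: "A \<in> sets (cspace I)"
  shows "emeasure (cspace I) A = ennreal (r\<^sup>2) ^ card I * emeasure (cspace I) (affine_map I t s -` A \<inter> space (cspace I))"
proof -
  have "cspace I = scale_measure (ennreal (r\<^sup>2) ^ card I) (distr (cspace I) (cspace I) (affine_map I t s))"
  proof (rule lborel_complex.PiM_eqI[symmetric])
    fix A :: "'i \<Rightarrow> complex set" assume A: "\<And>i. i \<in> I \<Longrightarrow> A i \<in> sets lborel"
    let ?g = "\<lambda>i x. t i + s i *\<^sub>R x"
    have m: "?g i -` A i \<in> sets borel" if "i \<in> I" for i
      using measurable_sets[of "?g i" borel borel "A i"] A[OF that] by simp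
    have pre: "affine_map I t s -` Pi\<^sub>E I A \<inter> space (cspace I) = Pi\<^sub>E I (\<lambda>i. ?g i -` A i)"
      by (auto simp: affine_map_def space_PiM PiE_iff extensional_def)
    have "emeasure (distr (cspace I) (cspace I) (affine_map I t s)) (Pi\<^sub>E I A)
        = (\<Prod>i\<in>I. emeasure lborel (?g i -` A i))"
      using A m \<open>finite I\<close> by (subst emeasure_distr) (auto simp: pre lborel_complex.emeasure_PiM intro!: sets_PiM_I_finite)
    moreover have "emeasure lborel (A i) = ennreal (r\<^sup>2) * emeasure lborel (?g i -` A i)" if "i \<in> I" for i
      using emeasure_lborel_affine_complex[of "s i" "A i" "t i"] A[OF that] s[OF that] \<open>r \<noteq> 0\<close>
      by (metis power_zero_numeral sets_lborel zero_eq_power2)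
    ultimately show "emeasure (scale_measure (ennreal (r\<^sup>2) ^ card I) (distr (cspace I) (cspace I) (affine_map I t s))) (Pi\<^sub>E I A)
        = (\<Prod>i\<in>I. emeasure lborel (A i))"
      by (simp add: prod.distrib)
  qed (use \<open>finite I\<close> in auto)
  then have "emeasure (cspace I) A = emeasure (scale_measure (ennreal (r\<^sup>2) ^ card I) (distr (cspace I) (cspace I) (affine_map I t s))) A"
    by simp
  then show ?thesis using A by (simp add: emeasure_distr)
qed


section \<open>Balls and their volumes\<close>

definition sq_sum :: "'i set \<Rightarrow> ('i \<Rightarrow> complex) \<Rightarrow> real" where
  "sq_sum I c = (\<Sum>i\<in>I. (cmod (c i))\<^sup>2)"

text \<open>The real part of the eigenfunction at the origin, where every character equals
  1.\<close>

definition re_sum :: "'i set \<Rightarrow> ('i \<Rightarrow> complex) \<Rightarrow> real" where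
  "re_sum I c = (\<Sum>i\<in>I. Re (c i))"

text \<open>The parameter bounds the squared norm: the radius is the square root of
  \<open>R\<close>, and the volume is proportional to the power \<open>card I\<close> of
  \<open>R\<close>.\<close>

definition sq_ball :: "'i set \<Rightarrow> real \<Rightarrow> ('i \<Rightarrow> complex) set" where
  "sq_ball I R = {c \<in> space (cspace I). sq_sum I c \<le> R}"

lemma measurable_sq_sum [measurable]: "sq_sum I \<in> borel_measurable (cspace I)"
  unfolding sq_sum_def by measurable

lemma measurable_re_sum [measurable]: "re_sum I \<in> borel_measurable (cspace I)"
  unfolding re_sum_def by measurable

lemma sets_sq_ball [measurable]: "sq_ball I R \<in> sets (cspace I)"
  unfolding sq_ball_def by measurable

lemma emeasure_sq_ball_finite:
  assumes "finite I" shows "emeasure (cspace I) (sq_ball I R) < \<infinity>"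
proof -
  have "sq_ball I R \<subseteq> Pi\<^sub>E I (\<lambda>_. cball 0 (sqrt R))"
  proof
    fix c assume c: "c \<in> sq_ball I R"
    have "cmod (c i) \<le> sqrt R" if "i \<in> I" for i
    proof (rule real_le_rsqrt)
      have "(cmod (c i))\<^sup>2 \<le> sq_sum I c"
        unfolding sq_sum_def by (rule member_le_sum[OF that]) (use assms in auto)
      then show "(cmod (c i))\<^sup>2 \<le> R" using c by (simp add: sq_ball_def)
    qed
    then show "c \<in> Pi\<^sub>E I (\<lambda>_. cball 0 (sqrt R))"
      using c by (auto simp: sq_ball_def space_PiM PiE_iff dist_norm)
  qed
  then have "emeasure (cspace I) (sq_ball I R) \<le> emeasure (cspace I) (Pi\<^sub>E I (\<lambda>_. cball 0 (sqrt R)))"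
    using assms by (intro emeasure_mono sets_PiM_I_finite) auto
  also have "\<dots> = (\<Prod>i\<in>I. emeasure lborel (cball (0::complex) (sqrt R)))"
    using assms by (subst lborel_complex.emeasure_PiM) auto
  also have "\<dots> < \<infinity>"
    using emeasure_lborel_cball_finite[of "0::complex" "sqrt R"]
    by (auto simp: ennreal_prod_eq_top less_top power_less_top_ennreal)
  finally show ?thesis .
qed

lemma emeasure_sq_ball_pos:
  assumes "finite I" "R > 0" shows "emeasure (cspace I) (sq_ball I R) > 0"
proof -
  \<comment> \<open>A polydisc of this radius fits in the ball; the extra 1 keeps the denominator
    positive when \<open>I\<close> is empty.\<close>
  define \<rho> where "\<rho> = sqrt (R / (card I + 1))"
  have \<rho>: "\<rho> > 0" "\<rho>\<^sup>2 = R / (card I + 1)" using assms by (auto simp: \<rho>_def)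
  have sub: "Pi\<^sub>E I (\<lambda>_. ball 0 \<rho>) \<subseteq> sq_ball I R"
  proof
    fix c assume c: "c \<in> Pi\<^sub>E I (\<lambda>_. ball (0::complex) \<rho>)"
    have "sq_sum I c \<le> (\<Sum>i\<in>I. \<rho>\<^sup>2)"
      unfolding sq_sum_def using c by (intro sum_mono power_mono) (auto simp: PiE_iff less_imp_le)
    also have "\<dots> \<le> R" using assms by (simp add: \<rho> field_simps)
    finally show "c \<in> sq_ball I R" using c by (auto simp: sq_ball_def space_PiM PiE_iff)
  qed
  have "emeasure (cspace I) (Pi\<^sub>E I (\<lambda>_. ball 0 \<rho>)) = (\<Prod>i\<in>I. emeasure lborel (ball (0::complex) \<rho>))"
    using assms by (subst lborel_complex.emeasure_PiM) auto
  moreover have "emeasure lborel (ball (0::complex) \<rho>) \<noteq> 0"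
    using \<rho> emeasure_lborel_open_pos[of "ball (0::complex) \<rho>"] by simp
  ultimately have "emeasure (cspace I) (Pi\<^sub>E I (\<lambda>_. ball 0 \<rho>)) \<noteq> 0"
    using assms(1) by simp
  then have "0 < emeasure (cspace I) (Pi\<^sub>E I (\<lambda>_. ball 0 \<rho>))" by (rule iffD2[OF zero_less_iff_neq_zero])
  also have "emeasure (cspace I) (Pi\<^sub>E I (\<lambda>_. ball 0 \<rho>)) \<le> emeasure (cspace I) (sq_ball I R)"
    using sub by (intro emeasure_mono) auto
  finally show ?thesis .
qed

lemma emeasure_sq_ball_scale:
  assumes "finite I" "q > 0"
  shows "emeasure (cspace I) (sq_ball I (q * R)) = ennreal q ^ card I * emeasure (cspace I) (sq_ball I R)"
proof -
  have "affine_map I (\<lambda>_. 0) (\<lambda>_. sqrt q) -` sq_ball I (q * R) \<inter> space (cspace I) = sq_ball I R"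
  proof -
    have "sq_sum I (affine_map I (\<lambda>_. 0) (\<lambda>_. sqrt q) c) = q * sq_sum I c" for c
      using assms by (simp add: sq_sum_def affine_map_def power_mult_distrib sum_distrib_left)
    then show ?thesis using assms
      by (auto simp: sq_ball_def space_PiM affine_map_def)
  qed
  then show ?thesis
    using emeasure_cspace_affine[of I "sqrt q" "\<lambda>_. sqrt q" "sq_ball I (q * R)" "\<lambda>_. 0"] assms by simp
qed

lemma abs_Re_le_sq_ball:
  assumes "finite I" "c \<in> sq_ball I R" "i \<in> I" shows "\<bar>Re (c i)\<bar> \<le> sqrt R"
proof (rule real_le_rsqrt)
  have "\<bar>Re (c i)\<bar>\<^sup>2 \<le> (cmod (c i))\<^sup>2" by (intro power_mono abs_Re_le_cmod) auto
  also have "\<dots> \<le> sq_sum I c"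
    unfolding sq_sum_def by (rule member_le_sum[OF assms(3)]) (use assms in auto)
  also have "\<dots> \<le> R" using assms by (simp add: sq_ball_def)
  finally show "\<bar>Re (c i)\<bar>\<^sup>2 \<le> R" .
qed

section \<open>The second moment of the coordinate sum\<close>

lemma distr_cspace_isometry:
  assumes "finite I" "\<And>i. i \<in> I \<Longrightarrow> (s i)\<^sup>2 = 1"
  shows "distr (cspace I) (cspace I) (affine_map I t s) = cspace I"
proof (rule measure_eqI)
  fix A assume "A \<in> sets (distr (cspace I) (cspace I) (affine_map I t s))"
  then have A: "A \<in> sets (cspace I)" by simp
  then show "emeasure (distr (cspace I) (cspace I) (affine_map I t s)) A = emeasure (cspace I) A"
    by (subst emeasure_cspace_affine[of I 1 s A t]) (use assms in \<open>auto simp: emeasure_distr\<close>)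
qed simp

lemma fmeasurable_sq_ball: "finite I \<Longrightarrow> sq_ball I R \<in> fmeasurable (cspace I)"
  using emeasure_sq_ball_finite[of I R] by (intro fmeasurableI) auto

lemma integrable_Re_prod:
  assumes "finite I" "i \<in> I" "j \<in> I"
  shows "integrable (cspace I) (\<lambda>c. indicator (sq_ball I R) c * (Re (c i) * Re (c j)))"
\<comment> \<open>The absolute value covers negative \<open>R\<close>, for which the ball is
  empty.\<close>
proof (rule Bochner_Integration.integrable_bound[where f="\<lambda>c. indicator (sq_ball I R) c * \<bar>R\<bar>"])
  show "integrable (cspace I) (\<lambda>c. indicator (sq_ball I R) c * \<bar>R\<bar>)"
    using emeasure_sq_ball_finite[OF assms(1), of R]
    by (intro integrable_mult_left integrable_real_indicator) auto
  show "(\<lambda>c. indicator (sq_ball I R) c * (Re (c i) * Re (c j))) \<in> borel_measurable (cspace I)"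
    using assms by measurable
  have "\<bar>Re (c i) * Re (c j)\<bar> \<le> \<bar>R\<bar>" if "c \<in> sq_ball I R" for c
  proof -
    have b: "\<bar>Re (c i)\<bar> \<le> sqrt R" "\<bar>Re (c j)\<bar> \<le> sqrt R" 
      using abs_Re_le_sq_ball[OF assms(1) that] assms by blast+
    then have "sqrt R \<ge> 0" using abs_ge_zero order_trans by blast
    then show ?thesis using mult_mono[OF b] by (simp add: abs_mult)
  qed
  then show "AE c in cspace I. norm (indicator (sq_ball I R) c * (Re (c i) * Re (c j)))
      \<le> norm (indicator (sq_ball I R) c * \<bar>R\<bar>)"
    by (intro AE_I2) (auto simp: indicator_def)
qed

lemma integral_Re_prod_eq_0:
  assumes "finite I" "i \<in> I" "j \<in> I" "i \<noteq> j"
  shows "(\<integral>c. indicator (sq_ball I R) c * (Re (c i) * Re (c j)) \<partial>cspace I) = 0"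
proof -
  let ?f = "\<lambda>c. indicator (sq_ball I R) c * (Re (c i) * Re (c j))"
  \<comment> \<open>Flipping coordinate \<open>i\<close> alone preserves the measure and the ball
    but negates the integrand.\<close>
  let ?G = "affine_map I (\<lambda>_. 0) ((\<lambda>_. 1)(i := -1))"
  have "integral\<^sup>L (cspace I) ?f = integral\<^sup>L (distr (cspace I) (cspace I) ?G) ?f"
    by (subst distr_cspace_isometry) (use assms in auto)
  also have "\<dots> = (\<integral>c. ?f (?G c) \<partial>cspace I)"
    by (intro integral_distr measurable_affine_map
        borel_measurable_integrable[OF integrable_Re_prod[OF assms(1-3)]])
  also have "\<dots> = (\<integral>c. - ?f c \<partial>cspace I)"
  proof (intro Bochner_Integration.integral_cong refl)
    fix c assume c: "c \<in> space (cspace I)"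
    have "sq_sum I (?G c) = sq_sum I c"
      unfolding sq_sum_def by (intro sum.cong) (auto simp: affine_map_def)
    moreover have "?G c \<in> space (cspace I)" by (auto simp: space_PiM affine_map_def)
    ultimately have "?G c \<in> sq_ball I R \<longleftrightarrow> c \<in> sq_ball I R" using c by (auto simp: sq_ball_def)
    then show "?f (?G c) = - ?f c" using assms by (auto simp: indicator_def affine_map_def)
  qed
  finally show ?thesis by simp
qed

text \<open>After expanding the square only the diagonal terms survive, and their sum is at most
  \<open>sq_sum I c\<close>, hence at most \<open>R\<close> on the ball. The bound therefore does
  not grow with the number of coordinates.\<close>

lemma integral_re_sum_sq_le:
  assumes "finite I"
  shows "(\<integral>c. indicator (sq_ball I R) c * (re_sum I c)\<^sup>2 \<partial>cspace I) \<le> R * measure (cspace I) (sq_ball I R)"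
    and "integrable (cspace I) (\<lambda>c. indicator (sq_ball I R) c * (re_sum I c)\<^sup>2)"
proof -
  let ?f = "\<lambda>i j c. indicator (sq_ball I R) c * (Re (c i) * Re (c j))"
  have eq: "indicator (sq_ball I R) c * (re_sum I c)\<^sup>2 = (\<Sum>i\<in>I. \<Sum>j\<in>I. ?f i j c)" for c
    unfolding re_sum_def power2_eq_square sum_product by (simp only: sum_distrib_left)
  show "integrable (cspace I) (\<lambda>c. indicator (sq_ball I R) c * (re_sum I c)\<^sup>2)"
    unfolding eq using integrable_Re_prod[OF assms] by (intro Bochner_Integration.integrable_sum) auto
  have "(\<integral>c. indicator (sq_ball I R) c * (re_sum I c)\<^sup>2 \<partial>cspace I)
      = (\<Sum>i\<in>I. \<Sum>j\<in>I. \<integral>c. ?f i j c \<partial>cspace I)"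
    unfolding eq using integrable_Re_prod[OF assms] by (simp add: Bochner_Integration.integral_sum)
  also have "\<dots> = (\<Sum>i\<in>I. \<integral>c. ?f i i c \<partial>cspace I)"
  proof (intro sum.cong refl)
    fix i assume i: "i \<in> I"
    have "(\<Sum>j\<in>I. \<integral>c. ?f i j c \<partial>cspace I) = (\<Sum>j\<in>I. if j = i then \<integral>c. ?f i i c \<partial>cspace I else 0)"
      using integral_Re_prod_eq_0[OF assms i] by (intro sum.cong) auto
    then show "(\<Sum>j\<in>I. \<integral>c. ?f i j c \<partial>cspace I) = (\<integral>c. ?f i i c \<partial>cspace I)"
      using assms i by simp
  qed
  also have "\<dots> = (\<integral>c. (\<Sum>i\<in>I. ?f i i c) \<partial>cspace I)"
    using integrable_Re_prod[OF assms] by (simp add: Bochner_Integration.integral_sum)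
  also have "\<dots> \<le> (\<integral>c. R * indicator (sq_ball I R) c \<partial>cspace I)"
  proof (rule integral_mono)
    show "integrable (cspace I) (\<lambda>c. \<Sum>i\<in>I. ?f i i c)"
      using integrable_Re_prod[OF assms] by (intro Bochner_Integration.integrable_sum) auto
    show "integrable (cspace I) (\<lambda>c. R * indicator (sq_ball I R) c)"
      using emeasure_sq_ball_finite[OF assms(1), of R]
      by (intro integrable_mult_right integrable_real_indicator) auto
    fix c
    have "(\<Sum>i\<in>I. Re (c i) * Re (c i)) \<le> sq_sum I c"
      unfolding sq_sum_def cmod_power2 by (intro sum_mono) (simp add: power2_eq_square)
    then show "(\<Sum>i\<in>I. ?f i i c) \<le> R * indicator (sq_ball I R) c"
      by (auto simp: sq_ball_def indicator_def)
  qed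
  also have "\<dots> = R * measure (cspace I) (sq_ball I R)"
    by (simp add: sets.sets_into_space[THEN Int_absorb2])
  finally show "(\<integral>c. indicator (sq_ball I R) c * (re_sum I c)\<^sup>2 \<partial>cspace I) \<le> R * measure (cspace I) (sq_ball I R)" .
qed

text \<open>Markov at the level 2R discards at most half of the ball. What remains is covered by two
  sets exchanged by negation, so each has at least a quarter of the volume.\<close>

lemma measure_re_sum_half:
  assumes "finite I" "R > 0"
  shows "measure (cspace I) (sq_ball I R)
    \<le> 4 * measure (cspace I) {c \<in> sq_ball I R. 0 \<le> re_sum I c \<and> (re_sum I c)\<^sup>2 < 2 * R}"
proof -
  let ?B = "sq_ball I R" and ?P = "cspace I"
  let ?F = "{c \<in> ?B. 0 \<le> re_sum I c \<and> (re_sum I c)\<^sup>2 < 2 * R}"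
  let ?F' = "{c \<in> ?B. re_sum I c \<le> 0 \<and> (re_sum I c)\<^sup>2 < 2 * R}"
  let ?E = "{c \<in> ?B. 2 * R \<le> (re_sum I c)\<^sup>2}"
  have B: "?B = {c \<in> space ?P. c \<in> ?B}" by (auto simp: sq_ball_def)
  have sets: "?F \<in> sets ?P" "?F' \<in> sets ?P" "?E \<in> sets ?P"
    unfolding sq_ball_def by (simp_all, measurable)
  have fm: "?F \<in> fmeasurable ?P" "?F' \<in> fmeasurable ?P" "?E \<in> fmeasurable ?P"
    by (rule fmeasurableI2[OF fmeasurable_sq_ball[OF assms(1), of R]]; use sets in auto)+
  have "emeasure ?P {c \<in> space ?P. 2 * R \<le> indicator ?B c * (re_sum I c)\<^sup>2}
      \<le> ennreal (1 / (2 * R) * (\<integral>c. indicator ?B c * (re_sum I c)\<^sup>2 \<partial>?P))"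
    using assms by (intro integral_Markov_inequality integral_re_sum_sq_le) auto
  \<comment> \<open>Outside the ball the left-hand function is 0, which is below the positive
    threshold.\<close>
  also have "{c \<in> space ?P. 2 * R \<le> indicator ?B c * (re_sum I c)\<^sup>2} = ?E"
    using assms by (auto simp: indicator_def sq_ball_def split: if_splits)
  finally have "measure ?P ?E \<le> 1 / (2 * R) * (\<integral>c. indicator ?B c * (re_sum I c)\<^sup>2 \<partial>?P)"
    using assms by (simp add: emeasure_eq_measure2[OF fm(3)] integral_nonneg_AE)
  also have "\<dots> \<le> 1 / (2 * R) * (R * measure ?P ?B)"
    using assms by (intro mult_left_mono integral_re_sum_sq_le) auto
  finally have E: "measure ?P ?E \<le> measure ?P ?B / 2" using assms by simp
  have "affine_map I (\<lambda>_. 0) (\<lambda>_. -1) -` ?F \<inter> space ?P = ?F'"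
    by (auto simp: sq_ball_def space_PiM affine_map_def sq_sum_def re_sum_def sum_negf)
  then have "emeasure ?P ?F = emeasure ?P ?F'"
    using emeasure_cspace_affine[of I 1 "\<lambda>_. -1" ?F "\<lambda>_. 0"] assms sets by simp
  then have F: "measure ?P ?F' = measure ?P ?F" by (simp add: measure_def)
  have "measure ?P ?B \<le> measure ?P (?F \<union> ?F' \<union> ?E)"
    using fm sets by (intro measure_mono_fmeasurable) auto
  also have "\<dots> \<le> measure ?P (?F \<union> ?F') + measure ?P ?E"
    using sets by (intro measure_Un_le) auto
  also have "measure ?P (?F \<union> ?F') \<le> measure ?P ?F + measure ?P ?F'"
    using sets by (intro measure_Un_le) auto
  finally show ?thesis using E F by linarith
qed

text \<open>The two constraints on the source set have separate roles: a nonnegative sum is moved to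
  at least \<open>a\<close>, and the upper bound on the sum controls the cross term in the new
  squared norm. Translations preserve volume, so the inclusion of sets gives the inequality.\<close>

lemma measure_re_sum_translate:
  assumes "finite I" "I \<noteq> {}" "R > 0" "a > 0"
    and t: "R + (2 * a * sqrt (2 * R) + a\<^sup>2) / card I \<le> t"
  shows "measure (cspace I) {c \<in> sq_ball I R. 0 \<le> re_sum I c \<and> (re_sum I c)\<^sup>2 < 2 * R}
    \<le> measure (cspace I) {c \<in> sq_ball I t. a \<le> re_sum I c}"
proof -
  let ?P = "cspace I" and ?N = "real (card I)"
  let ?F = "{c \<in> sq_ball I R. 0 \<le> re_sum I c \<and> (re_sum I c)\<^sup>2 < 2 * R}"
  let ?A = "{c \<in> sq_ball I t. a \<le> re_sum I c}"
  let ?G = "affine_map I (\<lambda>_. of_real (a / ?N)) (\<lambda>_. 1)"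
  have N: "?N > 0" using assms by (simp add: card_gt_0_iff)
  have sets: "?F \<in> sets ?P" "?A \<in> sets ?P"
    unfolding sq_ball_def by (simp_all, measurable)
  have fm: "?A \<in> fmeasurable ?P"
    by (rule fmeasurableI2[OF fmeasurable_sq_ball[OF assms(1), of t]]; use sets in auto)
  have re: "re_sum I (?G c) = re_sum I c + a" for c
    using N by (simp add: re_sum_def affine_map_def sum.distrib)
  have sq: "sq_sum I (?G c) = sq_sum I c + (2 * a * re_sum I c + a\<^sup>2) / ?N" for c
  proof -
    have "sq_sum I (?G c) = (\<Sum>i\<in>I. (cmod (c i))\<^sup>2 + (2 * (a / ?N) * Re (c i) + (a / ?N)\<^sup>2))"
      unfolding sq_sum_def affine_map_def
      by (intro sum.cong) (simp_all add: cmod_power2, simp add: power2_eq_square algebra_simps)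
    also have "\<dots> = sq_sum I c + (2 * (a / ?N) * re_sum I c + ?N * (a / ?N)\<^sup>2)"
      by (simp add: sum.distrib sq_sum_def re_sum_def sum_distrib_left)
    also have "\<dots> = sq_sum I c + (2 * a * re_sum I c + a\<^sup>2) / ?N"
      using N by (simp add: power2_eq_square field_simps)
    finally show ?thesis .
  qed
  have "?F \<subseteq> ?G -` ?A \<inter> space ?P"
  proof
    fix c assume c: "c \<in> ?F"
    have "re_sum I c \<le> sqrt (2 * R)" using c by (intro real_le_rsqrt) auto
    then have "(2 * a * re_sum I c + a\<^sup>2) / ?N \<le> (2 * a * sqrt (2 * R) + a\<^sup>2) / ?N"
      using assms N by (intro divide_right_mono add_right_mono mult_left_mono) auto
    then have "sq_sum I (?G c) \<le> t" unfolding sq using c t by (auto simp: sq_ball_def)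
    moreover have "a \<le> re_sum I (?G c)" unfolding re using c by simp
    moreover have "?G c \<in> space ?P" by (simp add: affine_map_def space_PiM)
    ultimately show "c \<in> ?G -` ?A \<inter> space ?P"
      using c \<open>a \<le> re_sum I (?G c)\<close> \<open>?G c \<in> space ?P\<close> by (simp add: sq_ball_def)
  qed
  then have "emeasure ?P ?F \<le> emeasure ?P (?G -` ?A \<inter> space ?P)"
    using sets by (intro emeasure_mono measurable_sets[OF measurable_affine_map]) auto
  also have "\<dots> = emeasure ?P ?A"
    using emeasure_cspace_affine[of I 1 "\<lambda>_. 1" ?A "\<lambda>_. of_real (a / ?N)"] assms sets by simp
  finally show ?thesis
    using fm by (simp add: measure_def enn2real_mono fmeasurable_def)
qed

text \<open>With q = 1 + x/N the parameter q times \<open>R\<^sub>0\<close> is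
  \<open>R\<^sub>0\<close> minus \<open>\<kappa>\<close>/N, which leaves the room the translation
  needs, while the volume ratio q^N tends to exp x. The constants are fixed before \<open>I\<close>,
  so the bound is uniform in the index set.\<close>

lemma measure_re_sum_lower_bound:
  assumes "R\<^sub>0 > 0" "a > 0"
  obtains \<delta> n\<^sub>0 where "\<delta> > 0" "\<And>I :: 'i set. finite I \<Longrightarrow> card I \<ge> n\<^sub>0 \<Longrightarrow>
     \<delta> * measure (cspace I) (sq_ball I R\<^sub>0) \<le> measure (cspace I) {c \<in> sq_ball I R\<^sub>0. a \<le> re_sum I c}"
proof -
  \<comment> \<open>N times the largest drift of the squared norm, computed at
    \<open>R\<^sub>0\<close>; it dominates the drift at the smaller parameter used below.\<close>
  define \<kappa> where "\<kappa> = 2 * a * sqrt (2 * R\<^sub>0) + a\<^sup>2"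
  define x where "x = - (\<kappa> / R\<^sub>0)"
  have \<kappa>: "\<kappa> > 0" using assms by (auto simp: \<kappa>_def intro!: add_nonneg_pos)
  have "(\<lambda>n. (1 + x / real n) ^ n) \<longlonglongrightarrow> exp x" by (rule tendsto_exp_limit_sequentially)
  then have "eventually (\<lambda>n. exp x / 2 < (1 + x / real n) ^ n) sequentially"
    by (rule order_tendstoD) simp
  then obtain n1 where n1: "\<And>n. n \<ge> n1 \<Longrightarrow> exp x / 2 < (1 + x / real n) ^ n"
    by (auto simp: eventually_sequentially)
  obtain n2 :: nat where n2: "\<kappa> / R\<^sub>0 < n2" using reals_Archimedean2 by blast
  show thesis
  proof (rule that)
    \<comment> \<open>One half comes from the eventual lower bound on q^N, one quarter from
      \<open>measure_re_sum_half\<close>.\<close>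
    show "exp x / 8 > 0" by simp
    fix I :: "'i set" assume I: "finite I" "card I \<ge> max (max n1 n2) 1"
    let ?N = "real (card I)" and ?P = "cspace I"
    define q where "q = 1 + x / ?N"
    have N: "?N > \<kappa> / R\<^sub>0" "?N > 0" using I n2 by auto
    have "q > 0" using N assms by (simp add: q_def x_def field_simps)
    have qN: "exp x / 2 < q ^ card I" using n1 I by (auto simp: q_def)
    have "q \<le> 1" using \<kappa> N assms by (simp add: q_def x_def)
    have qR: "q * R\<^sub>0 = R\<^sub>0 - \<kappa> / ?N" using assms N by (simp add: q_def x_def field_simps)
    have "q * R\<^sub>0 + (2 * a * sqrt (2 * (q * R\<^sub>0)) + a\<^sup>2) / ?N \<le> q * R\<^sub>0 + \<kappa> / ?N"
      unfolding \<kappa>_def using assms N \<open>q \<le> 1\<close>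
      by (intro add_left_mono divide_right_mono add_right_mono mult_left_mono real_sqrt_le_mono) auto
    also have "\<dots> = R\<^sub>0" using qR by simp
    finally have t: "q * R\<^sub>0 + (2 * a * sqrt (2 * (q * R\<^sub>0)) + a\<^sup>2) / ?N \<le> R\<^sub>0" .
    have "I \<noteq> {}" using N by auto
    have "exp x / 8 * measure ?P (sq_ball I R\<^sub>0) \<le> (q ^ card I / 4) * measure ?P (sq_ball I R\<^sub>0)"
      using qN by (intro mult_right_mono) auto
    also have "\<dots> = measure ?P (sq_ball I (q * R\<^sub>0)) / 4"
      using emeasure_sq_ball_scale[OF I(1) \<open>q > 0\<close>, of R\<^sub>0] \<open>q > 0\<close>
      by (simp add: measure_def enn2real_mult ennreal_power)
    also have "\<dots> \<le> measure ?P {c \<in> sq_ball I (q * R\<^sub>0). 0 \<le> re_sum I c \<and> (re_sum I c)\<^sup>2 < 2 * (q * R\<^sub>0)}"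
      using measure_re_sum_half[OF I(1), of "q * R\<^sub>0"] \<open>q > 0\<close> assms by simp
    also have "\<dots> \<le> measure ?P {c \<in> sq_ball I R\<^sub>0. a \<le> re_sum I c}"
      using \<open>q > 0\<close> assms I \<open>I \<noteq> {}\<close> t by (intro measure_re_sum_translate) auto
    finally show "exp x / 8 * measure ?P (sq_ball I R\<^sub>0) \<le> measure ?P {c \<in> sq_ball I R\<^sub>0. a \<le> re_sum I c}" .
  qed
qed

subsection \<open>Fourier characters on the torus\<close>

definition torus_cell :: "(real ^ 'd) set" where
  "torus_cell = {x. \<forall>i. 0 \<le> x $ i \<and> x $ i < 2 * pi}"

lemma sets_torus_cell [measurable]: "torus_cell \<in> sets borel"
  unfolding torus_cell_def by measurable

lemma torus_eq: "torus = restrict_space lborel torus_cell"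
  by (simp add: torus_def torus_cell_def)

lemma space_torus [simp]: "space torus = torus_cell"
  by (simp add: torus_eq space_restrict_space)

lemma finite_measure_torus: "finite_measure (torus :: (real ^ 'd) measure)"
proof
  have "torus_cell \<subseteq> cbox (0 :: real ^ 'd) (vec (2 * pi))"
    by (auto simp: torus_cell_def mem_box_cart less_imp_le)
  then have "emeasure lborel (torus_cell :: (real ^ 'd) set) < \<infinity>"
    by (intro le_less_trans[OF emeasure_mono emeasure_lborel_cbox_finite]) auto
  then show "emeasure (torus :: (real ^ 'd) measure) (space torus) \<noteq> \<infinity>"
    by (auto simp: torus_eq emeasure_restrict_space)
qed

lemma borel_measurable_torus: "f \<in> borel_measurable borel \<Longrightarrow> f \<in> borel_measurable torus"
  unfolding torus_eq by (intro measurable_restrict_space1) simp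

text \<open>Lebesgue measure on a Euclidean space is the image of a product indexed by
  \<open>Basis\<close>, so the integral is taken over that product first; \<open>ix\<close> recovers
  the coordinate index from a basis vector.\<close>

lemma lborel_integral_prod_cart:
  fixes F :: "'d::finite \<Rightarrow> real \<Rightarrow> complex"
  assumes F: "\<And>i. integrable lborel (F i)"
  shows "(\<integral>x. (\<Prod>i\<in>UNIV. F i (x $ i)) \<partial>lborel) = (\<Prod>i\<in>UNIV. \<integral>t. F i t \<partial>lborel)"
proof -
  interpret product_sigma_finite "\<lambda>_::real ^ 'd. lborel :: real measure" ..
  have [measurable]: "F i \<in> borel_measurable borel" for i
    using borel_measurable_integrable[OF F[of i]] by simp
  define ix where "ix = the_inv (\<lambda>i::'d. axis i (1::real))"
  have inj: "inj (\<lambda>i::'d. axis i (1::real))" by (auto simp: inj_def axis_eq_axis)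
  have ix: "ix (axis i 1) = i" for i unfolding ix_def by (rule the_inv_f_f[OF inj])
  have B: "(Basis :: (real ^ 'd) set) = range (\<lambda>i. axis i 1)" by (auto simp: Basis_vec_def)
  have sel: "(\<Sum>b\<in>Basis. f b *\<^sub>R b) $ i = f (axis i 1)" for f and i :: 'd
  proof -
    have "(\<Sum>b\<in>Basis. f b *\<^sub>R b) $ i = (\<Sum>b\<in>Basis. f b *\<^sub>R b) \<bullet> axis i 1"
      by (simp add: inner_axis)
    then show ?thesis by (simp add: inner_sum_left_Basis)
  qed
  have "(\<integral>x. (\<Prod>i\<in>UNIV. F i (x $ i)) \<partial>lborel)
      = (\<integral>y. (\<Prod>i\<in>UNIV. F i (y (axis i 1))) \<partial>(\<Pi>\<^sub>M b\<in>(Basis :: (real ^ 'd) set). lborel))"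
    by (subst lborel_eq, subst integral_distr) (measurable, simp only: sel)
  also have "\<dots> = (\<integral>y. (\<Prod>b\<in>Basis. F (ix b) (y b)) \<partial>(\<Pi>\<^sub>M b\<in>(Basis :: (real ^ 'd) set). lborel))"
    unfolding B by (simp add: prod.reindex[OF inj] ix)
  also have "\<dots> = (\<Prod>b\<in>(Basis :: (real ^ 'd) set). \<integral>t. F (ix b) t \<partial>lborel)"
    using F by (intro product_integral_prod) auto
  also have "\<dots> = (\<Prod>i\<in>UNIV. \<integral>t. F i t \<partial>lborel)"
    unfolding B by (simp add: prod.reindex[OF inj] ix)
  finally show ?thesis .
qed

lemma integral_exp_period:
  fixes m :: int
  defines "f \<equiv> \<lambda>t. exp (\<i> * of_real (of_int m * t))"
  shows "integrable lborel (\<lambda>t. indicator {0..<2 * pi} t *\<^sub>R f t)"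
    and "(\<integral>t. indicator {0..<2 * pi} t *\<^sub>R f t \<partial>lborel) = (if m = 0 then of_real (2 * pi) else 0)"
proof -
  have cont: "continuous_on A f" for A unfolding f_def by (intro continuous_intros)
  \<comment> \<open>The fundamental theorem of calculus is applied on the closed interval; the
    half-open one of the cell differs from it by a null point.\<close>
  have ae: "AE t in lborel. indicator {0..2 * pi} t *\<^sub>R f t = indicator {0..<2 * pi} t *\<^sub>R f t"
    using AE_lborel_singleton[of "2 * pi"] by eventually_elim (auto simp: indicator_def)
  have int: "integrable lborel (\<lambda>t. indicator {0..2 * pi} t *\<^sub>R f t)"
    using borel_integrable_atLeastAtMost'[OF cont] unfolding set_integrable_def .
  have [measurable]: "f \<in> borel_measurable borel"
    by (rule borel_measurable_continuous_onI[OF cont])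
  show "integrable lborel (\<lambda>t. indicator {0..<2 * pi} t *\<^sub>R f t)"
    by (rule integrable_cong_AE_imp[OF int _ ae]) measurable
  have "(\<integral>t. indicator {0..<2 * pi} t *\<^sub>R f t \<partial>lborel) = (\<integral>t. indicator {0..2 * pi} t *\<^sub>R f t \<partial>lborel)"
    using ae by (intro integral_cong_AE) (measurable, auto)
  also have "\<dots> = (if m = 0 then of_real (2 * pi) else 0)"
  proof (cases "m = 0")
    case True
    have "(\<integral>t. indicator {0..2 * pi} t *\<^sub>R f t \<partial>lborel) = complex_of_real (2 * pi) - complex_of_real 0"
      using cont has_vector_derivative_of_real[OF DERIV_ident]
      by (intro integral_FTC_atLeastAtMost) (auto simp: f_def True)
    then show ?thesis using True by simp
  next
    case False
    define F where "F t = f t / (\<i> * of_int m)" for t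
    have "((\<lambda>z. exp (\<i> * (of_int m * z)) / (\<i> * of_int m)) has_field_derivative f t) (at (of_real t))" for t
      using False by (auto intro!: derivative_eq_intros simp: f_def mult_ac)
    from has_vector_derivative_real_field[OF this]
    have "(F has_vector_derivative f t) (at t within {0..2 * pi})" for t
      by (simp add: F_def[abs_def] f_def)
    then have "(\<integral>t. indicator {0..2 * pi} t *\<^sub>R f t \<partial>lborel) = F (2 * pi) - F 0"
      using cont by (intro integral_FTC_atLeastAtMost) auto
    \<comment> \<open>Here \<open>m\<close> being an integer enters: the antiderivative takes equal
      values at both ends of the period.\<close>
    also have "f (2 * pi) = 1"
      unfolding f_def using exp_eq_1[of "\<i> * complex_of_real (of_int m * (2 * pi))"] by auto
    then have "F (2 * pi) - F 0 = 0" by (simp add: F_def f_def)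
    finally show ?thesis using False by simp
  qed
  finally show "(\<integral>t. indicator {0..<2 * pi} t *\<^sub>R f t \<partial>lborel) = (if m = 0 then of_real (2 * pi) else 0)" .
qed

lemma continuous_fourier_char: "continuous_on A (fourier_char n)"
  unfolding fourier_char_def by (intro continuous_intros)

lemma fourier_char_0 [simp]: "fourier_char n 0 = 1"
  by (simp add: fourier_char_def)

lemma norm_fourier_char [simp]: "cmod (fourier_char n x) = 1"
  unfolding fourier_char_def by (rule norm_exp_i_times)

text \<open>The indicator of the cell and the product of characters both factor over the
  coordinates, so the integral is a product of one-dimensional period integrals; one of them
  vanishes as soon as \<open>n\<close> and \<open>m\<close> differ somewhere.\<close>

lemma fourier_char_orthogonal:
  fixes n m :: "int ^ 'd"
  shows "(\<integral>x. fourier_char n x * cnj (fourier_char m x) \<partial>torus) = (if n = m then (2 * pi) ^ CARD('d) else 0)"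
proof -
  let ?F = "\<lambda>i t. indicator {0..<2 * pi} t *\<^sub>R exp (\<i> * of_real (of_int (n $ i - m $ i) * t))"
  have F: "integrable lborel (?F i)" for i by (rule integral_exp_period)
  have eq: "indicator torus_cell x *\<^sub>R (fourier_char n x * cnj (fourier_char m x)) = (\<Prod>i\<in>UNIV. ?F i (x $ i))" for x
  proof -
    have ind: "indicator torus_cell x = (\<Prod>i\<in>UNIV. indicator {0..<2 * pi} (x $ i) :: real)"
    proof (cases "x \<in> torus_cell")
      case True then show ?thesis by (simp add: torus_cell_def indicator_def)
    next
      case False
      then obtain i where "\<not> (0 \<le> x $ i \<and> x $ i < 2 * pi)" by (auto simp: torus_cell_def)
      then have "(\<Prod>i\<in>UNIV. indicator {0..<2 * pi} (x $ i) :: real) = 0"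
        by (intro prod_zero) (auto intro!: bexI[of _ i] simp: indicator_def)
      then show ?thesis using False by simp
    qed
    have "fourier_char n x * cnj (fourier_char m x)
        = exp (\<i> * of_real (\<Sum>i\<in>UNIV. of_int (n $ i) * x $ i) + cnj (\<i> * of_real (\<Sum>i\<in>UNIV. of_int (m $ i) * x $ i)))"
      by (simp only: fourier_char_def exp_cnj exp_add)
    also have "\<dots> = exp (\<Sum>i\<in>UNIV. \<i> * of_real (of_int (n $ i - m $ i) * x $ i))"
      by (simp add: sum_distrib_left sum_subtractf sum_negf algebra_simps)
    also have "\<dots> = (\<Prod>i\<in>UNIV. exp (\<i> * of_real (of_int (n $ i - m $ i) * x $ i)))"
      by (simp add: exp_sum)
    finally show ?thesis unfolding ind
      by (simp add: scaleR_conv_of_real prod.distrib)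
  qed
  have "(\<integral>x. fourier_char n x * cnj (fourier_char m x) \<partial>torus) = (\<integral>x. (\<Prod>i\<in>UNIV. ?F i (x $ i)) \<partial>lborel)"
    unfolding torus_eq by (subst integral_restrict_space) (simp_all add: eq del: of_real_mult)
  also have "\<dots> = (\<Prod>i\<in>UNIV. \<integral>t. ?F i t \<partial>lborel)"
    by (rule lborel_integral_prod_cart[OF F])
  also have "\<dots> = (\<Prod>i\<in>UNIV. if n $ i - m $ i = 0 then of_real (2 * pi) else 0)"
    by (subst integral_exp_period) simp
  also have "\<dots> = (if n = m then (2 * pi) ^ CARD('d) else 0)"
  proof (cases "n = m")
    case False
    then obtain i where "n $ i \<noteq> m $ i" by (auto simp: vec_eq_iff)
    then have "(\<Prod>i\<in>UNIV. if n $ i - m $ i = 0 then complex_of_real (2 * pi) else 0) = 0"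
      by (intro prod_zero) (auto intro!: bexI[of _ i])
    then show ?thesis using False by simp
  qed simp
  finally show ?thesis .
qed

section \<open>Parseval's identity\<close>

lemma finite_freqs: "finite (freqs k :: (int ^ 'd) set)"
proof -
  have "freqs k \<subseteq> vec_lambda ` (Pi\<^sub>E (UNIV :: 'd set) (\<lambda>_. {- int k..int k}))"
  proof
    fix n :: "int ^ 'd" assume n: "n \<in> freqs k"
    have "\<bar>n $ i\<bar> \<le> int k" for i
    proof -
      have "\<bar>n $ i\<bar> \<le> (n $ i)\<^sup>2"
        by (metis abs_le_square_iff abs_of_nonneg linorder_not_less nle_le power2_abs self_le_power abs_ge_zero zero_less_numeral int_one_le_iff_zero_less order_le_less zero_le_power2)
      also have "\<dots> \<le> (\<Sum>i\<in>UNIV. (n $ i)\<^sup>2)" by (rule member_le_sum) auto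
      finally show ?thesis using n by (simp add: freqs_def)
    qed
    then have "($) n \<in> Pi\<^sub>E UNIV (\<lambda>_. {- int k..int k})" by (auto simp: abs_le_iff minus_le_iff)
    then show "n \<in> vec_lambda ` (Pi\<^sub>E UNIV (\<lambda>_. {- int k..int k}))"
      by (intro image_eqI[of _ _ "($) n"]) auto
  qed
  then show ?thesis by (rule finite_subset) (intro finite_imageI finite_PiE, auto)
qed

lemma continuous_trig_poly: "continuous_on A (trig_poly k c)"
  unfolding trig_poly_def by (intro continuous_intros continuous_fourier_char)

lemma integrable_torus_fourier: "integrable torus (\<lambda>x. a * (fourier_char n x * cnj (fourier_char m x)))"
proof -
  interpret finite_measure torus by (rule finite_measure_torus)
  have "(\<lambda>x. a * (fourier_char n x * cnj (fourier_char m x))) \<in> borel_measurable torus"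
    by (intro borel_measurable_torus borel_measurable_continuous_onI continuous_intros continuous_fourier_char)
  then show ?thesis by (intro integrable_const_bound[where B="cmod a"]) (auto simp: norm_mult)
qed

lemma L2_norm_trig_poly:
  fixes c :: "int ^ 'd \<Rightarrow> complex"
  shows "L2_norm (trig_poly k c) = sqrt ((2 * pi) ^ CARD('d) * sq_sum (freqs k) c)"
proof -
  \<comment> \<open>The squared modulus is lifted to the complex numbers, where it expands into a
    double sum to which orthogonality applies.\<close>
  have eq: "complex_of_real ((cmod (trig_poly k c x))\<^sup>2)
      = (\<Sum>n\<in>freqs k. \<Sum>m\<in>freqs k. (c n * cnj (c m)) * (fourier_char n x * cnj (fourier_char m x)))" for x
    unfolding complex_norm_square trig_poly_def cnj_sum sum_product
    by (intro sum.cong) (simp_all add: mult_ac)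
  have "complex_of_real (\<integral>x. (cmod (trig_poly k c x))\<^sup>2 \<partial>torus)
      = (\<integral>x. complex_of_real ((cmod (trig_poly k c x))\<^sup>2) \<partial>torus)"
    by (rule integral_complex_of_real[symmetric])
  also have "\<dots> = (\<Sum>n\<in>freqs k. \<Sum>m\<in>freqs k. \<integral>x. (c n * cnj (c m)) * (fourier_char n x * cnj (fourier_char m x)) \<partial>torus)"
    unfolding eq
    by (subst Bochner_Integration.integral_sum, intro Bochner_Integration.integrable_sum integrable_torus_fourier,
      intro sum.cong refl Bochner_Integration.integral_sum integrable_torus_fourier)
  also have "\<dots> = (\<Sum>n\<in>freqs k. \<Sum>m\<in>freqs k. if n = m then (c n * cnj (c n)) * (2 * pi) ^ CARD('d) else 0)"
    by (intro sum.cong refl) (simp only: integral_mult_right_zero fourier_char_orthogonal, simp)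
  also have "\<dots> = (\<Sum>n\<in>freqs k. (c n * cnj (c n)) * (2 * pi) ^ CARD('d))"
    by (simp add: finite_freqs)
  also have "\<dots> = complex_of_real ((2 * pi) ^ CARD('d) * sq_sum (freqs k) c)"
    by (simp only: sq_sum_def sum_distrib_left of_real_sum of_real_mult complex_norm_square) (simp add: mult_ac)
  finally have "(\<integral>x. (cmod (trig_poly k c x))\<^sup>2 \<partial>torus) = (2 * pi) ^ CARD('d) * sq_sum (freqs k) c"
    by (simp only: of_real_eq_iff)
  then show ?thesis by (simp add: L2_norm_def)
qed

subsection \<open>The unit spheres as metric spaces\<close>

lemma trig_poly_diff: "trig_poly k c x - trig_poly k c' x = trig_poly k (\<lambda>n. c n - c' n) x"
  by (simp add: trig_poly_def sum_subtractf left_diff_distrib)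

lemma trig_poly_divide: "trig_poly k c x / s = trig_poly k (\<lambda>n. c n / s) x"
  by (simp add: trig_poly_def sum_divide_distrib)

lemma trig_poly_cong: "(\<And>n. n \<in> freqs k \<Longrightarrow> c n = c' n) \<Longrightarrow> trig_poly k c = trig_poly k c'"
  by (simp add: trig_poly_def fun_eq_iff)

lemma L2_norm_nonneg: "0 \<le> L2_norm u"
  by (simp add: L2_norm_def)

text \<open>In this form Minkowski's inequality and the comparison with the sum of moduli are
  inherited from \<open>L2_set\<close>.\<close>

lemma L2_norm_trig_poly_L2_set:
  fixes c :: "int ^ 'd \<Rightarrow> complex"
  shows "L2_norm (trig_poly k c) = sqrt ((2 * pi) ^ CARD('d)) * L2_set (\<lambda>n. cmod (c n)) (freqs k)"
  by (simp add: L2_norm_trig_poly sq_sum_def L2_set_def real_sqrt_mult)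

lemma L2_norm_trig_poly_le_sum:
  fixes c :: "int ^ 'd \<Rightarrow> complex"
  shows "L2_norm (trig_poly k c) \<le> sqrt ((2 * pi) ^ CARD('d)) * (\<Sum>n\<in>freqs k. cmod (c n))"
  unfolding L2_norm_trig_poly_L2_set by (intro mult_left_mono L2_set_le_sum) auto

lemma L2_norm_trig_poly_eq_0: "L2_norm (trig_poly k c) = 0 \<longleftrightarrow> (\<forall>n\<in>freqs k. c n = 0)"
  by (simp add: L2_norm_trig_poly_L2_set L2_set_eq_0_iff finite_freqs)

lemma L2_norm_trig_poly_add:
  "L2_norm (trig_poly k (\<lambda>n. c n + c' n)) \<le> L2_norm (trig_poly k c) + L2_norm (trig_poly k c')"
proof -
  have "L2_set (\<lambda>n. cmod (c n + c' n)) (freqs k) \<le> L2_set (\<lambda>n. cmod (c n) + cmod (c' n)) (freqs k)"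
    by (intro L2_set_mono norm_triangle_ineq) auto
  also have "\<dots> \<le> L2_set (\<lambda>n. cmod (c n)) (freqs k) + L2_set (\<lambda>n. cmod (c' n)) (freqs k)"
    by (rule L2_set_triangle_ineq)
  finally show ?thesis
    unfolding L2_norm_trig_poly_L2_set distrib_left[symmetric] by (rule mult_left_mono) simp
qed

abbreviation L2_dist :: "(real ^ 'd \<Rightarrow> complex) \<Rightarrow> (real ^ 'd \<Rightarrow> complex) \<Rightarrow> real" where
  "L2_dist u v \<equiv> L2_norm (\<lambda>x. u x - v x)"

lemma L2_dist_trig_poly: "L2_dist (trig_poly k c) (trig_poly k c') = L2_norm (trig_poly k (\<lambda>n. c n - c' n))"
  by (simp add: trig_poly_diff)

lemma L2_dist_triangle:
  "L2_dist (trig_poly k a) (trig_poly k c) \<le> L2_dist (trig_poly k a) (trig_poly k b) + L2_dist (trig_poly k b) (trig_poly k c)"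
  using L2_norm_trig_poly_add[of k "\<lambda>n. a n - b n" "\<lambda>n. b n - c n"] by (simp add: L2_dist_trig_poly)

lemma L2_dist_commute: "L2_dist u v = L2_dist v u"
  by (simp add: L2_norm_def norm_minus_commute)

lemma unit_sphereE:
  assumes "u \<in> unit_sphere k"
  obtains c where "u = trig_poly k c"
  using assms by (auto simp: unit_sphere_def eigenspace_def)

text \<open>Points are functions, not classes modulo null sets. Distinct points still have positive
  distance, because a vanishing L2 norm forces all coefficients of a trigonometric polynomial to be
  0.\<close>

lemma Metric_space_unit_sphere: "Metric_space (unit_sphere k) L2_dist"
proof
  show "L2_dist u v = L2_dist v u" for u v :: "real ^ 'a \<Rightarrow> complex" by (rule L2_dist_commute)
  fix u v w :: "real ^ 'a \<Rightarrow> complex" assume u: "u \<in> unit_sphere k" and v: "v \<in> unit_sphere k"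
  obtain a b where ab: "u = trig_poly k a" "v = trig_poly k b" using u v by (meson unit_sphereE)
  show "L2_dist u v = 0 \<longleftrightarrow> u = v"
  proof
    assume "L2_dist u v = 0"
    then show "u = v" unfolding ab L2_dist_trig_poly L2_norm_trig_poly_eq_0
      by (intro trig_poly_cong) auto
  qed (simp add: L2_norm_def)
  assume w: "w \<in> unit_sphere k"
  show "L2_dist u w \<le> L2_dist u v + L2_dist v w"
    using w unfolding ab by (elim unit_sphereE) (simp only: L2_dist_triangle)
qed (rule L2_norm_nonneg)

interpretation unit_sphere: Metric_space "unit_sphere k" L2_dist for k
  by (rule Metric_space_unit_sphere)

lemma space_sphere_borel [simp]: "space (sphere_borel k) = unit_sphere k"
  by (simp add: sphere_borel_def space_measure_of_conv)

lemma sphere_borel_opens_subset: "{V. openin (unit_sphere.mtopology k) V} \<subseteq> Pow (unit_sphere k)"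
  using openin_subset[where U="unit_sphere.mtopology k"] by auto

lemma sets_sphere_borel_open:
  assumes "\<And>u. u \<in> V \<Longrightarrow> u \<in> unit_sphere k"
    and "\<And>u. u \<in> V \<Longrightarrow> \<exists>r>0. \<forall>v\<in>unit_sphere k. L2_dist u v < r \<longrightarrow> v \<in> V"
  shows "V \<in> sets (sphere_borel k)"
proof -
  have "openin (unit_sphere.mtopology k) V"
    unfolding unit_sphere.openin_mtopology
  proof (intro conjI allI impI subsetI)
    fix u assume "u \<in> V"
    then obtain r where "r > 0" "\<forall>v\<in>unit_sphere k. L2_dist u v < r \<longrightarrow> v \<in> V" using assms(2) by blast
    then show "\<exists>r>0. unit_sphere.mball k u r \<subseteq> V" by (intro exI[of _ r]) auto
  qed (rule assms(1))
  then have "V \<in> sigma_sets (unit_sphere k) {V. openin (unit_sphere.mtopology k) V}"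
    by (intro sigma_sets.Basic) simp
  then show ?thesis
    unfolding sphere_borel_def sets_measure_of[OF sphere_borel_opens_subset] .
qed

section \<open>The sup norm on an eigenspace\<close>

lemma norm_trig_poly_le:
  fixes c :: "int ^ 'd \<Rightarrow> complex"
  shows "cmod (trig_poly k c x) \<le> card (freqs k :: (int ^ 'd) set) * L2_norm (trig_poly k c)"
proof -
  have "cmod (c n) \<le> L2_norm (trig_poly k c)" if "n \<in> freqs k" for n
  proof -
    have "cmod (c n) \<le> L2_set (\<lambda>n. cmod (c n)) (freqs k)"
      by (rule member_le_L2_set[OF finite_freqs that])
    also have "\<dots> \<le> L2_norm (trig_poly k c)"
    proof -
      have "1 \<le> (2 * pi) ^ CARD('d)" using pi_ge_two by (intro one_le_power) auto
      then have "1 \<le> sqrt ((2 * pi) ^ CARD('d))" by (rule real_sqrt_ge_one)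
      from mult_right_mono[OF this L2_set_nonneg] show ?thesis
        unfolding L2_norm_trig_poly_L2_set by simp
    qed
    finally show ?thesis .
  qed
  then have "(\<Sum>n\<in>freqs k. cmod (c n)) \<le> card (freqs k :: (int ^ 'd) set) * L2_norm (trig_poly k c)"
    by (rule sum_bounded_above)
  moreover have "cmod (trig_poly k c x) \<le> (\<Sum>n\<in>freqs k. cmod (c n))"
    unfolding trig_poly_def by (rule order_trans[OF norm_sum]) (simp add: norm_mult)
  ultimately show ?thesis by linarith
qed

lemma Linf_norm_trig_poly_le_iff:
  "Linf_norm (trig_poly k c) \<le> ereal C \<longleftrightarrow> (AE x in torus. cmod (trig_poly k c x) \<le> C)"
proof
  assume le: "Linf_norm (trig_poly k c) \<le> ereal C"
  have "AE x in torus. ereal (cmod (trig_poly k c x)) \<le> Linf_norm (trig_poly k c)"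
    unfolding Linf_norm_def by (rule esssup_AE)
  then show "AE x in torus. cmod (trig_poly k c x) \<le> C"
    by eventually_elim (use le order_trans ereal_less_eq(3) in blast)
next
  assume "AE x in torus. cmod (trig_poly k c x) \<le> C"
  moreover have "(\<lambda>x. ereal (cmod (trig_poly k c x))) \<in> borel_measurable torus"
    by (intro borel_measurable_ereal borel_measurable_torus borel_measurable_continuous_onI
        continuous_on_norm continuous_trig_poly)
  ultimately show "Linf_norm (trig_poly k c) \<le> ereal C"
    unfolding Linf_norm_def by (intro esssup_I) auto
qed

text \<open>Continuity of the sup norm in the L2 distance at fixed \<open>k\<close>. The constant is
  crude and grows with the multiplicity, but it only serves measurability.\<close>

lemma Linf_norm_trig_poly_perturb:
  fixes a b :: "int ^ 'd \<Rightarrow> complex"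
  assumes "Linf_norm (trig_poly k a) \<le> ereal C"
  shows "Linf_norm (trig_poly k b)
    \<le> ereal (C + card (freqs k :: (int ^ 'd) set) * L2_dist (trig_poly k b) (trig_poly k a))"
proof -
  have "cmod (trig_poly k b x) \<le> cmod (trig_poly k a x)
      + card (freqs k :: (int ^ 'd) set) * L2_dist (trig_poly k b) (trig_poly k a)" for x
    using norm_trig_poly_le[of k "\<lambda>n. b n - a n" x] norm_triangle_ineq2[of "trig_poly k b x" "trig_poly k a x"]
    by (simp add: trig_poly_diff)
  then show ?thesis
    using assms unfolding Linf_norm_trig_poly_le_iff
    by (elim eventually_mono) (meson add_right_mono order_trans)
qed

text \<open>The complement is open: a gap between \<open>C\<close> and the sup norm survives small
  L2 perturbations.\<close>

lemma sets_Linf_norm_le: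
  "{u :: real ^ 'd \<Rightarrow> complex. u \<in> unit_sphere k \<and> Linf_norm u \<le> ereal C} \<in> sets (sphere_borel k)"
proof -
  let ?V = "{u :: real ^ 'd \<Rightarrow> complex. u \<in> unit_sphere k \<and> ereal C < Linf_norm u}"
  have "?V \<in> sets (sphere_borel k)"
  proof (rule sets_sphere_borel_open)
    fix u :: "real ^ 'd \<Rightarrow> complex" assume u: "u \<in> ?V"
    \<comment> \<open>A real number strictly in between makes the gap a real quantity, although
      \<open>Linf_norm\<close> is an extended real.\<close>
    then obtain C' where C': "ereal C < ereal C'" "ereal C' < Linf_norm u" using ereal_dense2 by blast
    obtain b where b: "u = trig_poly k b" using u unit_sphereE by blast
    let ?N = "real (card (freqs k :: (int ^ 'd) set))"
    define r where "r = (C' - C) / (?N + 1)"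
    have "r > 0" using C' by (simp add: r_def)
    moreover have "v \<in> ?V" if v: "v \<in> unit_sphere k" and d: "L2_dist u v < r" for v
    proof (rule ccontr)
      assume "v \<notin> ?V"
      then have le: "Linf_norm v \<le> ereal C" using v by auto
      obtain a where a: "v = trig_poly k a" using v unit_sphereE by blast
      have "Linf_norm u \<le> ereal (C + ?N * L2_dist u v)"
        using Linf_norm_trig_poly_perturb[of k a C b] le by (simp add: a b)
      moreover have "?N * L2_dist u v \<le> (?N + 1) * r"
        using d by (intro mult_mono) (auto simp: L2_norm_nonneg)
      then have "C + ?N * L2_dist u v \<le> C'" by (simp add: r_def)
      ultimately have "Linf_norm u \<le> ereal C'" using order_trans ereal_less_eq(3) by blast
      then show False using C' by simp
    qed
    ultimately show "\<exists>r>0. \<forall>v\<in>unit_sphere k. L2_dist u v < r \<longrightarrow> v \<in> ?V" by blast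
  qed auto
  then have "space (sphere_borel k) - ?V \<in> sets (sphere_borel k)" by (rule sets.compl_sets)
  also have "space (sphere_borel k) - ?V = {u \<in> unit_sphere k. Linf_norm u \<le> ereal C}" by auto
  finally show ?thesis .
qed

text \<open>By continuity a value above \<open>C\<close> at 0 persists on a neighbourhood, but 0 is
  a corner of the cell and the neighbourhood sticks out of it. The open unit box lies in the cell
  and has 0 in its closure, so it meets the neighbourhood in a nonempty open set, which has positive
  measure.\<close>

lemma norm_at_0_le_Linf_norm:
  fixes c :: "int ^ 'd \<Rightarrow> complex"
  assumes "Linf_norm (trig_poly k c) \<le> ereal C"
  shows "cmod (trig_poly k c 0) \<le> C"
proof (rule ccontr)
  assume gt: "\<not> cmod (trig_poly k c 0) \<le> C"
  let ?B = "box 0 (vec 1) :: (real ^ 'd) set"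
  define S where "S = {x. C < cmod (trig_poly k c x)}"
  have "open S" unfolding S_def
    by (intro open_Collect_less continuous_on_const continuous_on_norm continuous_trig_poly)
  have "?B \<noteq> {}" by (simp add: interval_ne_empty_cart)
  then have "0 \<in> S \<inter> closure ?B" using gt by (auto simp: S_def closure_box mem_box_cart)
  then have "S \<inter> ?B \<noteq> {}" using open_Int_closure_eq_empty[OF \<open>open S\<close>] by blast
  moreover have "open (S \<inter> ?B)" using \<open>open S\<close> by (intro open_Int open_box)
  ultimately have pos: "emeasure lborel (S \<inter> ?B) > 0" by (intro emeasure_lborel_open_pos)
  have "?B \<subseteq> torus_cell"
    using pi_ge_two by (auto simp: torus_cell_def mem_box_cart intro: less_imp_le less_trans[of _ 1])
  moreover have "AE x in lborel. x \<in> torus_cell \<longrightarrow> cmod (trig_poly k c x) \<le> C"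
    using assms unfolding Linf_norm_trig_poly_le_iff torus_eq by (subst (asm) AE_restrict_space_iff) auto
  ultimately have "AE x in lborel. x \<notin> S \<inter> ?B" by (auto simp: S_def elim!: eventually_mono)
  then have "S \<inter> ?B \<in> null_sets lborel"
    using \<open>open (S \<inter> ?B)\<close> by (subst AE_iff_null_sets) auto
  then show False using pos by auto
qed

subsection \<open>The uniform probability on the sphere\<close>

definition radial :: "nat \<Rightarrow> (int ^ 'd \<Rightarrow> complex) \<Rightarrow> real ^ 'd \<Rightarrow> complex" where
  "radial k c = (\<lambda>x. trig_poly k c x / of_real (L2_norm (trig_poly k c)))"

lemma radial_eq_trig_poly: "radial k c = trig_poly k (\<lambda>n. c n / of_real (L2_norm (trig_poly k c)))"
  by (simp add: radial_def trig_poly_divide)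

lemma measurable_L2_norm_trig_poly [measurable]:
  "(\<lambda>c. L2_norm (trig_poly k c)) \<in> borel_measurable (cspace (freqs k))"
  unfolding L2_norm_trig_poly by measurable

lemma sets_ball_coeffs [measurable]: "ball_coeffs k \<in> sets (cspace (freqs k))"
proof -
  have "ball_coeffs k = {c \<in> space (cspace (freqs k)). 0 < L2_norm (trig_poly k c) \<and> L2_norm (trig_poly k c) \<le> 1}"
    by (auto simp: ball_coeffs_def space_PiM)
  also have "\<dots> \<in> sets (cspace (freqs k))" by measurable
  finally show ?thesis .
qed

lemma ball_coeffs_subset_space: "ball_coeffs k \<subseteq> space (cspace (freqs k))"
  using sets.sets_into_space sets_ball_coeffs by blast

lemma L2_norm_divide: "s > 0 \<Longrightarrow> L2_norm (\<lambda>x. u x / of_real s) = L2_norm u / s"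
  by (simp add: L2_norm_def norm_divide power_divide real_sqrt_divide)

lemma radial_in_unit_sphere:
  assumes "c \<in> ball_coeffs k" shows "radial k c \<in> unit_sphere k"
proof -
  define s where "s = L2_norm (trig_poly k c)"
  have "s > 0" using assms by (simp add: ball_coeffs_def s_def)
  then have "L2_norm (radial k c) = s / s"
    unfolding radial_def s_def[symmetric] by (subst L2_norm_divide) (simp_all add: s_def)
  then have "L2_norm (radial k c) = 1" using \<open>s > 0\<close> by simp
  then show ?thesis by (auto simp: unit_sphere_def eigenspace_def radial_eq_trig_poly)
qed

text \<open>Preimages of arbitrary open sets reduce to countably many balls by separability: the
  centres have coefficients in a countable dense set and the radii are reciprocals of integers. For
  one such ball, membership of \<open>radial k c\<close> is a measurable inequality in
  \<open>c\<close> by Parseval.\<close>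

lemma sphere_open_preimage:
  fixes V :: "(real ^ 'd \<Rightarrow> complex) set"
  assumes V: "openin (unit_sphere.mtopology k) V"
  shows "radial k -` V \<inter> ball_coeffs k \<in> sets (cspace (freqs k))"
proof -
  obtain D :: "complex set" where D: "countable D" "\<And>X. open X \<Longrightarrow> X \<noteq> {} \<Longrightarrow> \<exists>d\<in>D. d \<in> X"
    by (rule countable_dense_setE) blast
  \<comment> \<open>The centre need not lie on the sphere, so this is not a ball of the metric
    space; the triangle inequality is available for all trigonometric polynomials.\<close>
  define B where "B q m = {v \<in> unit_sphere k. L2_dist v (trig_poly k q) < 1 / real (Suc m)}"
    for q :: "int ^ 'd \<Rightarrow> complex" and m
  define Q where "Q = {(q, m). q \<in> freqs k \<rightarrow>\<^sub>E D \<and> B q m \<subseteq> V}"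
  have "countable Q"
    by (rule countable_subset[of _ "(freqs k \<rightarrow>\<^sub>E D) \<times> UNIV"])
      (auto simp: Q_def intro!: countable_SIGMA countable_PiE finite_freqs D)
  have cover: "\<exists>(q, m)\<in>Q. u \<in> B q m" if u: "u \<in> V" for u
  proof -
    obtain \<epsilon> where \<epsilon>: "\<epsilon> > 0" "unit_sphere.mball k u \<epsilon> \<subseteq> V"
      using V u unfolding unit_sphere.openin_mtopology by blast
    have uS: "u \<in> unit_sphere k" using V u unfolding unit_sphere.openin_mtopology by blast
    then obtain c where c: "u = trig_poly k c" by (rule unit_sphereE)
    \<comment> \<open>Half of \<open>\<epsilon>\<close>, because two points of one small ball are
      compared through its centre.\<close>
    obtain m where m: "inverse (real (Suc m)) < \<epsilon> / 2" using reals_Archimedean[of "\<epsilon> / 2"] \<epsilon> by auto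
    \<comment> \<open>Coefficient errors below \<open>\<eta>\<close> give an L2 error below 1/(m+1);
      the added 1 makes the estimate strict and covers an empty frequency set.\<close>
    define \<eta> where "\<eta> = 1 / (real (Suc m) * sqrt ((2 * pi) ^ CARD('d)) * (card (freqs k :: (int ^ 'd) set) + 1))"
    have "\<eta> > 0" by (simp add: \<eta>_def)
    have "\<exists>d\<in>D. d \<in> ball (c n) \<eta>" for n using \<open>\<eta> > 0\<close> by (intro D(2)) auto
    then obtain q0 where q0: "\<And>n. q0 n \<in> D" "\<And>n. dist (c n) (q0 n) < \<eta>" unfolding mem_ball by metis
    define q where "q = restrict q0 (freqs k)"
    have "(\<Sum>n\<in>freqs k. cmod (c n - q n)) \<le> card (freqs k :: (int ^ 'd) set) * \<eta>"
      using q0(2) by (intro sum_bounded_above) (auto simp: q_def dist_norm less_imp_le)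
    also have "\<dots> < (card (freqs k :: (int ^ 'd) set) + 1) * \<eta>" using \<open>\<eta> > 0\<close> by simp
    finally have lt: "(\<Sum>n\<in>freqs k. cmod (c n - q n)) < (card (freqs k :: (int ^ 'd) set) + 1) * \<eta>" .
    have "L2_dist u (trig_poly k q) \<le> sqrt ((2 * pi) ^ CARD('d)) * (\<Sum>n\<in>freqs k. cmod (c n - q n))"
      unfolding c L2_dist_trig_poly by (rule L2_norm_trig_poly_le_sum)
    also have "\<dots> < sqrt ((2 * pi) ^ CARD('d)) * ((card (freqs k :: (int ^ 'd) set) + 1) * \<eta>)"
      using lt by (intro mult_strict_left_mono) auto
    also have "\<dots> = 1 / real (Suc m)" by (simp add: \<eta>_def field_simps del: of_nat_Suc)
    finally have d: "L2_dist u (trig_poly k q) < 1 / real (Suc m)" .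
    have "B q m \<subseteq> V"
    proof
      fix v assume v: "v \<in> B q m"
      then obtain b where b: "v = trig_poly k b" unfolding B_def using unit_sphereE by blast
      have "L2_dist u v \<le> L2_dist u (trig_poly k q) + L2_dist (trig_poly k q) v"
        unfolding b c by (rule L2_dist_triangle)
      also have "L2_dist (trig_poly k q) v = L2_dist v (trig_poly k q)" by (rule L2_dist_commute)
      finally have "L2_dist u v < \<epsilon>" using d m v by (simp add: B_def inverse_eq_divide)
      then show "v \<in> V" using \<epsilon>(2) v uS by (auto simp: B_def)
    qed
    moreover have "q \<in> freqs k \<rightarrow>\<^sub>E D" using q0(1) by (auto simp: q_def)
    ultimately show ?thesis using d uS by (intro bexI[of _ "(q, m)"]) (auto simp: Q_def B_def)
  qed
  have "radial k -` V \<inter> ball_coeffs k = (\<Union>(q, m)\<in>Q. {c \<in> ball_coeffs k. radial k c \<in> B q m})"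
    using cover by (fastforce simp: Q_def)
  also have "\<dots> \<in> sets (cspace (freqs k))"
  proof (rule sets.countable_UN'[OF \<open>countable Q\<close>], clarify)
    fix q m
    have "{c \<in> ball_coeffs k. radial k c \<in> B q m} = {c \<in> space (cspace (freqs k)). c \<in> ball_coeffs k \<and>
        L2_norm (trig_poly k (\<lambda>n. c n / of_real (L2_norm (trig_poly k c)) - q n)) < 1 / real (Suc m)}"
      using radial_in_unit_sphere ball_coeffs_subset_space
      by (auto simp: B_def) (auto simp: radial_eq_trig_poly L2_dist_trig_poly trig_poly_diff)
    also have "\<dots> \<in> sets (cspace (freqs k))"
    proof -
      have [measurable]: "(\<lambda>c. L2_norm (trig_poly k (\<lambda>n. c n / of_real (L2_norm (trig_poly k c)) - q n)))
          \<in> borel_measurable (cspace (freqs k))"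
        by (subst L2_norm_trig_poly) (unfold sq_sum_def, measurable)
      show ?thesis by measurable
    qed
    finally show "{c \<in> ball_coeffs k. radial k c \<in> B q m} \<in> sets (cspace (freqs k))" .
  qed
  finally show ?thesis .
qed

section \<open>The sphere law as a ratio of volumes\<close>

lemma sets_ball_uniform: "sets (ball_uniform k) = sets (restrict_space (cspace (freqs k)) (ball_coeffs k))"
  by (simp add: ball_uniform_def)

lemma space_ball_uniform: "space (ball_uniform k) = ball_coeffs k"
  using ball_coeffs_subset_space by (auto simp: ball_uniform_def space_restrict_space)

lemma sets_ball_uniform_iff: "A \<in> sets (ball_uniform k) \<longleftrightarrow> A \<subseteq> ball_coeffs k \<and> A \<in> sets (cspace (freqs k))"
  unfolding sets_ball_uniform by (rule sets_restrict_space_iff) simp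

lemma measurable_radial: "radial k \<in> measurable (ball_uniform k) (sphere_borel k)"
  unfolding sphere_borel_def
proof (rule measurable_measure_of[OF sphere_borel_opens_subset])
  show "radial k \<in> space (ball_uniform k) \<rightarrow> unit_sphere k"
    using radial_in_unit_sphere by (auto simp: space_ball_uniform)
  show "radial k -` V \<inter> space (ball_uniform k) \<in> sets (ball_uniform k)"
    if "V \<in> {V. openin (unit_sphere.mtopology k) V}" for V
    using that sphere_open_preimage[of k V] by (simp add: space_ball_uniform sets_ball_uniform_iff)
qed

lemma ball_coeffs_eq:
  fixes k :: nat
  shows "(ball_coeffs k :: (int ^ 'd \<Rightarrow> complex) set)
    = sq_ball (freqs k) (1 / (2 * pi) ^ CARD('d)) - (freqs k \<rightarrow>\<^sub>E {0})"
proof -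
  have pos: "(2 * pi) ^ CARD('d) > 0" by simp
  have "L2_norm (trig_poly k c) \<le> 1 \<longleftrightarrow> sq_sum (freqs k) c \<le> 1 / (2 * pi) ^ CARD('d)" for c :: "int ^ 'd \<Rightarrow> complex"
    using pos unfolding L2_norm_trig_poly real_sqrt_le_1_iff by (simp add: pos_le_divide_eq mult.commute)
  moreover have "0 < L2_norm (trig_poly k c) \<longleftrightarrow> \<not> (\<forall>n\<in>freqs k. c n = 0)" for c :: "int ^ 'd \<Rightarrow> complex"
    using L2_norm_trig_poly_eq_0[of k c] L2_norm_nonneg[of "trig_poly k c"] unfolding less_le by auto
  ultimately have "c \<in> ball_coeffs k
      \<longleftrightarrow> c \<in> sq_ball (freqs k) (1 / (2 * pi) ^ CARD('d)) - (freqs k \<rightarrow>\<^sub>E {0})" for c :: "int ^ 'd \<Rightarrow> complex"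
    unfolding ball_coeffs_def sq_ball_def space_PiM Diff_iff PiE_iff mem_Collect_eq singleton_iff by auto
  then show ?thesis by blast
qed

text \<open>The origin is a null set once there is a frequency. With none, coefficient space is a
  single point of mass 1 and puncturing it would remove everything.\<close>

lemma emeasure_ball_coeffs:
  assumes "(freqs k :: (int ^ 'd) set) \<noteq> {}"
  shows "emeasure (cspace (freqs k)) (ball_coeffs k :: (int ^ 'd \<Rightarrow> complex) set)
    = emeasure (cspace (freqs k :: (int ^ 'd) set)) (sq_ball (freqs k) (1 / (2 * pi) ^ CARD('d)))"
proof -
  have "emeasure (cspace (freqs k :: (int ^ 'd) set)) (freqs k \<rightarrow>\<^sub>E {0}) = (\<Prod>n\<in>(freqs k :: (int ^ 'd) set). emeasure lborel {0::complex})"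
    by (rule lborel_complex.emeasure_PiM) (auto simp: finite_freqs)
  also have "\<dots> = 0" using assms by (simp add: finite_freqs card_gt_0_iff)
  finally have "(freqs k \<rightarrow>\<^sub>E {0}) \<in> null_sets (cspace (freqs k :: (int ^ 'd) set))"
    by (intro null_setsI sets_PiM_I_finite finite_freqs) auto
  then show ?thesis unfolding ball_coeffs_eq by (intro emeasure_Diff_null_set) auto
qed

lemma emeasure_sphere_uniform:
  fixes A :: "(real ^ 'd \<Rightarrow> complex) set"
  assumes "A \<in> sets (sphere_borel k)"
  shows "emeasure (sphere_uniform k) A
    = emeasure (cspace (freqs k)) (radial k -` A \<inter> ball_coeffs k)
      / emeasure (cspace (freqs k)) (ball_coeffs k :: (int ^ 'd \<Rightarrow> complex) set)"
proof -
  have eq: "sphere_uniform k = distr (ball_uniform k) (sphere_borel k) (radial k)"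
    by (simp add: sphere_uniform_def radial_def[abs_def])
  let ?R = "restrict_space (cspace (freqs k)) (ball_coeffs k :: (int ^ 'd \<Rightarrow> complex) set)"
  have s: "radial k -` A \<inter> ball_coeffs k \<in> sets ?R"
    using measurable_sets[OF measurable_radial assms] by (simp add: space_ball_uniform sets_ball_uniform)
  have b: "ball_coeffs k \<in> sets ?R" by (simp add: sets_restrict_space_iff)
  have "emeasure (sphere_uniform k) A = emeasure (ball_uniform k) (radial k -` A \<inter> ball_coeffs k)"
    unfolding eq by (subst emeasure_distr[OF measurable_radial assms]) (simp add: space_ball_uniform)
  also have "\<dots> = emeasure ?R (ball_coeffs k \<inter> (radial k -` A \<inter> ball_coeffs k)) / emeasure ?R (ball_coeffs k)"
    unfolding ball_uniform_def by (rule emeasure_uniform_measure[OF b s])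
  also have "ball_coeffs k \<inter> (radial k -` A \<inter> ball_coeffs k) = radial k -` A \<inter> ball_coeffs k" by blast
  finally show ?thesis by (simp add: emeasure_restrict_space)
qed

subsection \<open>Sup norms of random eigenfunctions\<close>

lemma space_sphere_uniform [simp]: "space (sphere_uniform k) = unit_sphere k"
  by (simp add: sphere_uniform_def)

lemma sets_sphere_uniform [simp]: "sets (sphere_uniform k) = sets (sphere_borel k)"
  by (simp add: sphere_uniform_def)

lemma prob_space_sphere_uniform:
  assumes "(freqs k :: (int ^ 'd) set) \<noteq> {}"
  shows "prob_space (sphere_uniform k :: (real ^ 'd \<Rightarrow> complex) measure)"
proof
  have eq: "radial k -` space (sphere_borel k) \<inter> ball_coeffs k = (ball_coeffs k :: (int ^ 'd \<Rightarrow> complex) set)"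
    using radial_in_unit_sphere by auto
  have "emeasure (cspace (freqs k)) (ball_coeffs k :: (int ^ 'd \<Rightarrow> complex) set) > 0"
    unfolding emeasure_ball_coeffs[OF assms] by (intro emeasure_sq_ball_pos finite_freqs) simp
  moreover have "emeasure (cspace (freqs k)) (ball_coeffs k :: (int ^ 'd \<Rightarrow> complex) set) < \<infinity>"
    unfolding emeasure_ball_coeffs[OF assms] by (intro emeasure_sq_ball_finite finite_freqs)
  ultimately have "emeasure (sphere_uniform k) (space (sphere_borel k) :: (real ^ 'd \<Rightarrow> complex) set) = 1"
    by (subst emeasure_sphere_uniform[OF sets.top], unfold eq, intro ennreal_divide_self) auto
  then show "emeasure (sphere_uniform k) (space (sphere_uniform k :: (real ^ 'd \<Rightarrow> complex) measure)) = 1" by simp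
qed

text \<open>The projection divides by a norm in (0, 1], so the unprojected value at 0 is no larger
  than the projected one. Thus the bound passes from the sphere to the ball without any estimate of
  the norm.\<close>

lemma re_sum_le_of_Linf_norm_radial:
  fixes c :: "int ^ 'd \<Rightarrow> complex"
  assumes c: "c \<in> ball_coeffs k" and le: "Linf_norm (radial k c) \<le> ereal C"
  shows "re_sum (freqs k) c \<le> C"
proof -
  define s where "s = L2_norm (trig_poly k c)"
  have s: "0 < s" "s \<le> 1" using c by (auto simp: ball_coeffs_def s_def)
  have "cmod (trig_poly k c 0) / s \<le> C"
    using norm_at_0_le_Linf_norm[OF le[unfolded radial_eq_trig_poly]] s
    unfolding radial_eq_trig_poly[symmetric] by (simp add: radial_def norm_divide s_def)
  moreover have "cmod (trig_poly k c 0) \<le> cmod (trig_poly k c 0) / s"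
    using s by (simp add: le_divide_eq mult_left_le)
  moreover have "re_sum (freqs k) c = Re (trig_poly k c 0)" by (simp add: re_sum_def trig_poly_def)
  ultimately show ?thesis using complex_Re_le_cmod[of "trig_poly k c 0"] by linarith
qed

lemma sphere_uniform_Linf_norm_le:
  assumes "C > 0"
  obtains \<delta> n\<^sub>0 where "0 < \<delta>" "\<And>k. card (freqs k :: (int ^ 'd) set) \<ge> n\<^sub>0 \<Longrightarrow> freqs k \<noteq> ({} :: (int ^ 'd) set) \<Longrightarrow>
    emeasure (sphere_uniform k) {u :: real ^ 'd \<Rightarrow> complex. u \<in> unit_sphere k \<and> Linf_norm u \<le> ereal C} \<le> ennreal (1 - \<delta>)"
proof -
  let ?R = "1 / (2 * pi) ^ CARD('d)"
  have R: "?R > 0" by simp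
  obtain \<delta> n\<^sub>0 where \<delta>: "\<delta> > 0" "\<And>I :: (int ^ 'd) set. finite I \<Longrightarrow> card I \<ge> n\<^sub>0 \<Longrightarrow>
     \<delta> * measure (cspace I) (sq_ball I ?R) \<le> measure (cspace I) {c \<in> sq_ball I ?R. C + 1 \<le> re_sum I c}"
    using measure_re_sum_lower_bound[OF R, of "C + 1"] assms by auto
  show thesis
  proof (rule that[OF \<delta>(1)])
    fix k assume k: "card (freqs k :: (int ^ 'd) set) \<ge> n\<^sub>0" "freqs k \<noteq> ({} :: (int ^ 'd) set)"
    let ?I = "freqs k :: (int ^ 'd) set"
    let ?P = "cspace ?I" and ?B = "sq_ball ?I ?R"
    let ?T = "{c \<in> ?B. C + 1 \<le> re_sum ?I c}"
    let ?A = "{u :: real ^ 'd \<Rightarrow> complex. u \<in> unit_sphere k \<and> Linf_norm u \<le> ereal C}"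
    have B: "?B \<in> fmeasurable ?P" by (intro fmeasurable_sq_ball finite_freqs)
    have T: "?T \<in> sets ?P" unfolding sq_ball_def by (simp, measurable)
    have v: "measure ?P ?B > 0"
      using emeasure_sq_ball_pos[OF finite_freqs R, of k] emeasure_eq_measure2[OF B]
      by (metis ennreal_less_zero_iff)
    \<comment> \<open>The level \<open>C + 1\<close> strictly exceeds the bound \<open>C\<close> on
      the sum, so this preimage misses \<open>?T\<close>.\<close>
    have "radial k -` ?A \<inter> ball_coeffs k \<subseteq> ?B - ?T"
      using re_sum_le_of_Linf_norm_radial[of _ k C] by (force simp: ball_coeffs_eq)
    then have "emeasure ?P (radial k -` ?A \<inter> ball_coeffs k) \<le> emeasure ?P (?B - ?T)"
      using T by (intro emeasure_mono) auto
    also have "\<dots> = ennreal (measure ?P (?B - ?T))"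
      using B T by (intro emeasure_eq_measure2 fmeasurable_Diff)
    also have "measure ?P (?B - ?T) = measure ?P ?B - measure ?P ?T"
      using B T by (intro measurable_measure_Diff) auto
    also have "ennreal \<dots> \<le> ennreal ((1 - \<delta>) * measure ?P ?B)"
      using \<delta>(2)[OF finite_freqs k(1)] by (intro ennreal_leI) (simp add: algebra_simps)
    finally have le: "emeasure ?P (radial k -` ?A \<inter> ball_coeffs k) \<le> ennreal ((1 - \<delta>) * measure ?P ?B)" .
    have "emeasure (sphere_uniform k) ?A = emeasure ?P (radial k -` ?A \<inter> ball_coeffs k) / emeasure ?P ?B"
      unfolding emeasure_sphere_uniform[OF sets_Linf_norm_le] emeasure_ball_coeffs[OF k(2)] ..
    also have "\<dots> \<le> ennreal ((1 - \<delta>) * measure ?P ?B) / emeasure ?P ?B"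
      by (rule divide_right_mono_ennreal[OF le])
    \<comment> \<open>For \<open>\<delta>\<close> above 1 both sides are 0, since
      \<open>ennreal\<close> truncates negative numbers.\<close>
    also have "\<dots> = ennreal (1 - \<delta>)"
      using v emeasure_eq_measure2[OF B]
      by (cases "\<delta> \<le> 1") (simp_all add: divide_ennreal ennreal_neg mult_nonpos_nonneg)
    finally show "emeasure (sphere_uniform k) ?A \<le> ennreal (1 - \<delta>)" .
  qed
qed

section \<open>Eigenvalues of large multiplicity\<close>

text \<open>The rational points $\left(\frac{1-t^2}{1+t^2}, \frac{2t}{1+t^2}\right)$ of the unit circle, $t < m$, cleared of
  denominators, lie on a common circle.\<close>
lemma ex_eig_mult_ge:
  assumes "CARD('d::finite) \<ge> 2"
  shows "\<exists>k. m \<le> eig_mult TYPE('d) k"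
proof -
  obtain i j :: 'd where ij: "i \<noteq> j"
    using assms card_le_Suc0_iff_eq[of "UNIV :: 'd set"] by auto
  \<comment> \<open>The cofactor of 1 + t^2 in the common denominator \<open>N\<close>, so that
    every point lands on the circle of radius \<open>N\<close>.\<close>
  define M where "M t = (\<Prod>s\<in>{..<m} - {t}. 1 + (int s)\<^sup>2)" for t
  define N where "N = (\<Prod>s<m. 1 + (int s)\<^sup>2)"
  define v :: "nat \<Rightarrow> int ^ 'd" where
    "v t = (\<chi> l. if l = i then M t * (1 - (int t)\<^sup>2) else if l = j then M t * (2 * int t) else 0)" for t
  have N: "N = (1 + (int t)\<^sup>2) * M t" if "t < m" for t
    using that by (simp add: N_def M_def prod.remove)
  have "N > 0" unfolding N_def by (intro prod_pos) (auto intro: add_pos_nonneg)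
  have "v t \<in> freqs (nat (N\<^sup>2))" if "t < m" for t
  proof -
    have "(\<Sum>l\<in>UNIV. (v t $ l)\<^sup>2) = (\<Sum>l\<in>{i, j}. (v t $ l)\<^sup>2)"
      by (rule sum.mono_neutral_right) (auto simp: v_def)
    also have "\<dots> = (M t * (1 - (int t)\<^sup>2))\<^sup>2 + (M t * (2 * int t))\<^sup>2"
      using ij by (simp add: v_def)
    also have "\<dots> = N\<^sup>2" unfolding N[OF that] by (simp add: power2_eq_square algebra_simps)
    finally show ?thesis by (simp add: freqs_def)
  qed
  then have sub: "v ` {..<m} \<subseteq> freqs (nat (N\<^sup>2))" by auto
  have "inj_on v {..<m}"
  proof (rule inj_onI)
    fix s t assume st: "s \<in> {..<m}" "t \<in> {..<m}" "v s = v t"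
    have "M s * (1 - (int s)\<^sup>2) = M t * (1 - (int t)\<^sup>2)"
      using arg_cong[OF st(3), of "\<lambda>w. w $ i"] by (simp add: v_def)
    moreover have "N = (1 + (int s)\<^sup>2) * M s" "N = (1 + (int t)\<^sup>2) * M t" using N st by auto
    ultimately have "(1 + (int t)\<^sup>2) * N * (1 - (int s)\<^sup>2) = (1 + (int s)\<^sup>2) * N * (1 - (int t)\<^sup>2)"
      by algebra
    then have "(1 + (int t)\<^sup>2) * (1 - (int s)\<^sup>2) = (1 + (int s)\<^sup>2) * (1 - (int t)\<^sup>2)"
      using \<open>N > 0\<close> by (simp add: mult.commute mult.left_commute)
    \<comment> \<open>The first coordinate (1 - t^2)/(1 + t^2) determines t^2, hence the natural
      number t.\<close>
    then have "(int s)\<^sup>2 = (int t)\<^sup>2" by (simp add: algebra_simps)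
    then show "s = t" by simp
  qed
  then have "m \<le> card (freqs (nat (N\<^sup>2)) :: (int ^ 'd) set)"
    using card_mono[OF finite_freqs sub] by (simp add: card_image)
  then show ?thesis by (auto simp: eig_mult_def)
qed

lemma infinite_eig_mult_ge:
  assumes "CARD('d::finite) \<ge> 2"
  shows "infinite {k. m \<le> eig_mult TYPE('d) k}"
proof
  assume fin: "finite {k. m \<le> eig_mult TYPE('d) k}"
  \<comment> \<open>A multiplicity above \<open>m\<close> puts its eigenvalue into the supposedly
    finite set, and then it cannot exceed the sum of all multiplicities there.\<close>
  let ?b = "m + (\<Sum>k | m \<le> eig_mult TYPE('d) k. eig_mult TYPE('d) k)"
  obtain k where k: "Suc ?b \<le> eig_mult TYPE('d) k" using ex_eig_mult_ge[OF assms] by blast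
  then have "eig_mult TYPE('d) k \<le> (\<Sum>k | m \<le> eig_mult TYPE('d) k. eig_mult TYPE('d) k)"
    by (intro member_le_sum fin) auto
  then show False using k by simp
qed

lemma freqs_nonempty_iff: "freqs k \<noteq> ({} :: (int ^ 'd) set) \<longleftrightarrow> k \<in> eigenvalues TYPE('d::finite)"
  by (auto simp: eigenvalues_def eig_mult_def Suc_le_eq card_gt_0_iff finite_freqs)

section \<open>Independence over infinitely many eigenvalues\<close>

lemma Linf_norm_bounded_null:
  assumes d: "CARD('d::finite) \<ge> 2" and "C > 0"
  shows "{U \<in> space (nu :: (nat \<Rightarrow> real ^ 'd \<Rightarrow> complex) measure).
      \<forall>k\<in>eigenvalues TYPE('d). Linf_norm (U k) \<le> ereal C} \<in> null_sets nu"
    (is "?S \<in> _")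
proof (rule null_setsI)
  let ?E = "eigenvalues TYPE('d)"
  let ?A = "\<lambda>k. {u :: real ^ 'd \<Rightarrow> complex. u \<in> unit_sphere k \<and> Linf_norm u \<le> ereal C}"
  show sets: "?S \<in> sets nu"
    unfolding nu_def
    by (intro sets.sets_Collect_countable_All' sets_Collect_single') (auto simp: sets_Linf_norm_le)
  obtain \<delta> n\<^sub>0 where \<delta>: "0 < \<delta>" "\<And>k. card (freqs k :: (int ^ 'd) set) \<ge> n\<^sub>0 \<Longrightarrow> freqs k \<noteq> ({} :: (int ^ 'd) set) \<Longrightarrow>
      emeasure (sphere_uniform k) (?A k) \<le> ennreal (1 - \<delta>)"
    by (rule sphere_uniform_Linf_norm_le[OF \<open>C > 0\<close>]) blast
  have le: "emeasure nu ?S \<le> ennreal (1 - \<delta>) ^ N" for N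
  proof -
    \<comment> \<open>Any \<open>N\<close> eigenvalues of large multiplicity give \<open>N\<close>
      independent factors; the maximum with 1 ensures that they belong to
      \<open>eigenvalues\<close>.\<close>
    obtain J where J: "finite J" "card J = N" "J \<subseteq> {k. max n\<^sub>0 1 \<le> eig_mult TYPE('d) k}"
      using infinite_arbitrarily_large[OF infinite_eig_mult_ge[OF d]] by blast
    have JE: "J \<subseteq> ?E" using J(3) by (auto simp: eigenvalues_def)
    have "?S \<subseteq> prod_emb ?E sphere_uniform J (Pi\<^sub>E J ?A)"
      using JE by (fastforce simp: nu_def prod_emb_def space_PiM PiE_iff restrict_def extensional_def)
    moreover have "prod_emb ?E sphere_uniform J (Pi\<^sub>E J ?A) \<in> sets nu"
      unfolding nu_def using J JE by (intro sets_PiM_I) (auto simp: sets_Linf_norm_le)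
    ultimately have "emeasure nu ?S \<le> emeasure nu (prod_emb ?E sphere_uniform J (Pi\<^sub>E J ?A))"
      by (rule emeasure_mono)
    also have "\<dots> = (\<Prod>k\<in>J. emeasure (sphere_uniform k) (?A k))"
      unfolding nu_def using J JE
      by (intro emeasure_PiM_emb prob_space_sphere_uniform) (auto simp: sets_Linf_norm_le freqs_nonempty_iff)
    also have "\<dots> \<le> (\<Prod>k\<in>J. ennreal (1 - \<delta>))"
      using J JE by (intro prod_mono_ennreal \<delta>(2)) (auto simp: eig_mult_def freqs_nonempty_iff)
    finally show ?thesis by (simp add: J(2))
  qed
  show "emeasure nu ?S = 0"
  proof (cases "\<delta> < 1")
    case True
    have "(\<lambda>N. ennreal ((1 - \<delta>) ^ N)) \<longlonglongrightarrow> ennreal 0"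
      using \<delta>(1) True by (intro tendsto_ennrealI LIMSEQ_realpow_zero) auto
    moreover have "emeasure nu ?S \<le> ennreal ((1 - \<delta>) ^ N)" for N
      using le[of N] True by (simp add: ennreal_power)
    ultimately have "emeasure nu ?S \<le> ennreal 0" by (intro LIMSEQ_le_const) auto
    then show ?thesis by simp
  next
    case False
    \<comment> \<open>When \<open>\<delta>\<close> is at least 1, a single factor is already
      0.\<close>
    then show ?thesis using le[of 1] by (simp add: ennreal_neg)
  qed
qed

theorem mainTheorem10:
  assumes "CARD('d::finite) \<ge> 2"
  shows "{U \<in> space (nu :: (nat \<Rightarrow> real ^ 'd \<Rightarrow> complex) measure).
            \<exists>C::real. C > 0 \<and> (\<forall>k\<in>eigenvalues TYPE('d). Linf_norm (U k) \<le> ereal C)}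
         \<in> null_sets nu"
proof -
  let ?S = "\<lambda>C. {U \<in> space (nu :: (nat \<Rightarrow> real ^ 'd \<Rightarrow> complex) measure).
      \<forall>k\<in>eigenvalues TYPE('d). Linf_norm (U k) \<le> ereal C}"
  \<comment> \<open>Integer bounds suffice and turn the uncountable union over \<open>C\<close> into
    a countable one; \<open>Suc\<close> keeps them positive.\<close>
  have "{U \<in> space (nu :: (nat \<Rightarrow> real ^ 'd \<Rightarrow> complex) measure).
      \<exists>C::real. C > 0 \<and> (\<forall>k\<in>eigenvalues TYPE('d). Linf_norm (U k) \<le> ereal C)} = (\<Union>m. ?S (real (Suc m)))"
  proof (intro set_eqI iffI)
    fix U :: "nat \<Rightarrow> real ^ 'd \<Rightarrow> complex" assume U: "U \<in> {U \<in> space nu.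
      \<exists>C::real. C > 0 \<and> (\<forall>k\<in>eigenvalues TYPE('d). Linf_norm (U k) \<le> ereal C)}"
    then obtain C where C: "\<forall>k\<in>eigenvalues TYPE('d). Linf_norm (U k) \<le> ereal C" by blast
    obtain m where "C \<le> real m" using real_arch_simple by blast
    then have "ereal C \<le> ereal (real (Suc m))" by simp
    then have "U \<in> ?S (real (Suc m))" using U C order_trans by blast
    then show "U \<in> (\<Union>m. ?S (real (Suc m)))" by blast
  next
    fix U assume "U \<in> (\<Union>m. ?S (real (Suc m)))"
    then obtain m where "U \<in> ?S (real (Suc m))" by blast
    moreover have "real (Suc m) > 0" by simp
    ultimately show "U \<in> {U \<in> space nu.
      \<exists>C::real. C > 0 \<and> (\<forall>k\<in>eigenvalues TYPE('d). Linf_norm (U k) \<le> ereal C)}" by blast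
  qed
  also have "\<dots> \<in> null_sets nu"
    using assms by (intro null_sets_UN Linf_norm_bounded_null) auto
  finally show ?thesis .
qed

end
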